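(* For any positive integers $N,K,M$ with $M\in[2:N]$, there exists a capacity-achieving linear $(\mu=M/N,N,K)$ SC-PIR scheme with sub-packetization $\eta\!\left(\frac{N}{\gcd(N,M)},\frac{M}{\gcd(N,M)}\right)\cdot(M-1)$.
   Context: Notation: $[a:b]=\{a,a+1,\dots,b\}$; entropies are in base $q$, where $q$ is a fixed prime power; $A_{1:N}=(A_1,\dots,A_N)$. The function $\eta(N,M)$ is defined recursively for integers $1\le M\le N$ with $\gcd(N,M)=1$ by: $\eta(N,M)=1$ if $N=1$; $\eta(N,M)=1+\eta(N-M,M)$ if $N>1$ and $N\ge2M$; $\eta(N,M)=1+\eta(M,2M-N)$ if $N>1$ and $N<2M$. A $(\mu,N,K)$ SC-PIR (storage constrained private information retrieval) scheme consists of the following. Files: $W_1,\dots,W_K$ are independent and uniform on $\mathbb F_q^L$, for some file length $L\ge1$ (part of the scheme, free to be chosen). Storage: each file $W_k$ is partitioned into $F$ disjoint nonempty packets $W_{k,1},\dots,W_{k,F}$, with $H(W_{k,i})$ not depending on $k$; $F$ is the sub-packetization. Server $n\in[1:N]$ stores $Z_n=\{W_{k,i}:k\in[1:K],i\in\mathcal Z_n\}$ for some $\mathcal Z_n\subseteq[1:F]$, every $i\in[1:F]$ lies in at least one $\mathcal Z_n$, and $H(Z_n)\le\mu KL$ for all $n$. Retrieval: for each desired index $\theta\in[1:K]$ there are random queries $Q_{1:N}^{[\theta]}$ and answers $A_{1:N}^{[\theta]}$ with $I(Q_{1:N}^{[\theta]};W_{1:K})=0$; $H(A_n^{[\theta]}|Q_n^{[\theta]},Z_n)=0$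 for all $n$; decodability $H(W_\theta|A_{1:N}^{[\theta]},Q_{1:N}^{[\theta]})=0$; and privacy: for every $n$, the distribution of $(Q_n^{[\theta]},A_n^{[\theta]},Z_n)$ does not depend on $\theta$. The average download cost over random queries is $D=\sum_{n=1}^N H(A_n^{[\theta]}|Q_n^{[\theta]})$ and the retrieval rate is $R=L/D$. For $M=\mu N\in[1:N]$ an integer the capacity (supremum of rates) is known to be $C^*=\left(1+\frac1M+\dots+\frac1{M^{K-1}}\right)^{-1}$; a scheme is capacity-achieving if $R=C^*$. The scheme is linear if each answer has the form $A_n^{[\theta]}=(\mathbf{LC}_{n,1}^{[\theta]}(Z_n),\dots,\mathbf{LC}_{n,\ell_n}^{[\theta]}(Z_n))$ with $\mathbf{LC}_{n,j}^{[\theta]}(Z_n)=\sum_{k\in[1:K]}\sum_{i\in\mathcal Z_n}\beta_{n,k,i,j}^{[\theta]}W_{k,i}$, where the length $\ell_n$ (possibly $0$, i.e. no answer) and the coefficients $\beta_{n,k,i,j}^{[\theta]}\in\mathbb F_q$ are determined by the query $Q_n^{[\theta]}$. Packets are vectors over $\mathbb F_q$; packets of different dimensions are added after zero-padding to the largest dimension. *)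

theory Defs
  imports "HOL-Probability.Probability" "HOL-Library.More_List"
begin

text \<open>
  The guard of the first case is met by coprime \<open>N, M\<close> with \<open>1 \<le> M \<le> N\<close> exactly if \<open>N = 1\<close>; it
  also makes the function total.  Below are the defining equations on the intended domain.
\<close>

fun eta :: "nat \<Rightarrow> nat \<Rightarrow> nat" where
  "eta N M =
    (if M = 0 \<or> N \<le> M then 1
     else if 2 * M \<le> N then 1 + eta (N - M) M
     else 1 + eta M (2 * M - N))"

declare eta.simps [simp del]

lemma eta_1: "eta 1 1 = 1"
  by (simp add: eta.simps)

lemma eta_rec:
  assumes "1 \<le> M" "M \<le> N" "coprime N M" "1 < N"
  shows "2 * M \<le> N \<Longrightarrow> eta N M = 1 + eta (N - M) M"
    and "N < 2 * M \<Longrightarrow> eta N M = 1 + eta M (2 * M - N)"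
proof -
  have "M < N"
    using assms by (cases "M = N") auto
  with assms show "2 * M \<le> N \<Longrightarrow> eta N M = 1 + eta (N - M) M"
    and "N < 2 * M \<Longrightarrow> eta N M = 1 + eta M (2 * M - N)"
    by (simp_all add: eta.simps [of N M])
qed

text \<open>The known value of the capacity \<open>C\<^sup>*\<close> for integral \<open>m = \<mu>N\<close>, see below.\<close>

definition sc_pir_capacity :: "real \<Rightarrow> nat \<Rightarrow> real" where
  "sc_pir_capacity m K = inverse (\<Sum>j<K. 1 / m ^ j)"

definition vectors :: "nat \<Rightarrow> 'a list set" where
  "vectors L = {w. length w = L}"

text \<open>
  Files, packets and servers are numbered from 1, the coordinates of a file from 0.  The finite
  field is the type \<open>'a\<close>.  The packet \<open>i\<close> of file \<open>k\<close> consists of the coordinates in \<open>P k i\<close>, in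
  increasing order.
\<close>

locale sc_pir_files = information_space \<Omega> "real CARD('a)"
  for \<Omega> :: "'w measure"
    and K :: nat
    and L :: nat
    and F :: nat
    and W :: "nat \<Rightarrow> 'w \<Rightarrow> 'a::{field, finite} list"
    and P :: "nat \<Rightarrow> nat \<Rightarrow> nat set" +
  assumes L_pos: "1 \<le> L"
    and files_indep: "indep_vars (\<lambda>_. count_space (vectors L)) W {1..K}"
    and files_uniform: "k \<in> {1..K} \<Longrightarrow>
      distr \<Omega> (count_space (vectors L)) (W k) = uniform_count_measure (vectors L)"
    and packets_nonempty: "k \<in> {1..K} \<Longrightarrow> i \<in> {1..F} \<Longrightarrow> P k i \<noteq> {}"
    and packets_disjoint: "k \<in> {1..K} \<Longrightarrow> disjoint_family_on (P k) {1..F}"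
    and packets_cover: "k \<in> {1..K} \<Longrightarrow> (\<Union>i\<in>{1..F}. P k i) = {..<L}"
begin

text \<open>Instantiating the base of the logarithm drops the notation of the library.\<close>

notation entropy_Pow (\<open>\<H>'(_')\<close>)
notation mutual_information_Pow (\<open>\<I>'(_ ; _')\<close>)
notation conditional_entropy_Pow (\<open>\<H>'(_ | _')\<close>)

definition packet :: "nat \<Rightarrow> nat \<Rightarrow> 'w \<Rightarrow> 'a list" where
  "packet k i \<omega> = nths (W k \<omega>) (P k i)"

definition all_files :: "'w \<Rightarrow> nat \<Rightarrow> 'a list" where
  "all_files \<omega> = (\<lambda>k\<in>{1..K}. W k \<omega>)"

end

text \<open>\<open>I n\<close> is the set of indices of the packets that server \<open>n\<close> stores of every file.\<close>

locale sc_pir_storage = sc_pir_files \<Omega> K L F W P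
  for \<Omega> :: "'w measure"
    and \<mu> :: real
    and N :: nat
    and K :: nat
    and L :: nat
    and F :: nat
    and W :: "nat \<Rightarrow> 'w \<Rightarrow> 'a::{field, finite} list"
    and P :: "nat \<Rightarrow> nat \<Rightarrow> nat set"
    and I :: "nat \<Rightarrow> nat set"
begin

definition stored :: "nat \<Rightarrow> 'w \<Rightarrow> nat \<times> nat \<Rightarrow> 'a list" where
  "stored n \<omega> = (\<lambda>(k, i)\<in>{1..K} \<times> I n. packet k i \<omega>)"

end

text \<open>
  The entropies of the library are meaningful for simple functions, whence the
  assumption that queries and answers take finitely many values.
\<close>

locale sc_pir_scheme = sc_pir_storage \<Omega> \<mu> N K L F W P I
  for \<Omega> :: "'w measure"
    and \<mu> :: real
    and N :: nat
    and K :: nat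
    and L :: nat
    and F :: nat
    and W :: "nat \<Rightarrow> 'w \<Rightarrow> 'a::{field, finite} list"
    and P :: "nat \<Rightarrow> nat \<Rightarrow> nat set"
    and I :: "nat \<Rightarrow> nat set"
    and Q :: "nat \<Rightarrow> nat \<Rightarrow> 'w \<Rightarrow> 'query"
    and A :: "nat \<Rightarrow> nat \<Rightarrow> 'w \<Rightarrow> 'answer" +
  assumes packet_entropy: "k \<in> {1..K} \<Longrightarrow> k' \<in> {1..K} \<Longrightarrow> i \<in> {1..F} \<Longrightarrow>
      \<H>(packet k i) = \<H>(packet k' i)"
    and storage_index: "n \<in> {1..N} \<Longrightarrow> I n \<subseteq> {1..F}"
    and storage_cover: "i \<in> {1..F} \<Longrightarrow> \<exists>n\<in>{1..N}. i \<in> I n"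
    and storage_limit: "n \<in> {1..N} \<Longrightarrow> \<H>(stored n) \<le> \<mu> * K * L"
    and queries_simple: "\<theta> \<in> {1..K} \<Longrightarrow> n \<in> {1..N} \<Longrightarrow> simple_function \<Omega> (Q \<theta> n)"
    and answers_simple: "\<theta> \<in> {1..K} \<Longrightarrow> n \<in> {1..N} \<Longrightarrow> simple_function \<Omega> (A \<theta> n)"
    and queries_files: "\<theta> \<in> {1..K} \<Longrightarrow>
      \<I>((\<lambda>\<omega>. \<lambda>n\<in>{1..N}. Q \<theta> n \<omega>) ; all_files) = 0"
    and answers_determined: "\<theta> \<in> {1..K} \<Longrightarrow> n \<in> {1..N} \<Longrightarrow>
      \<H>(A \<theta> n | (\<lambda>\<omega>. (Q \<theta> n \<omega>, stored n \<omega>))) = 0"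
    and decodable: "\<theta> \<in> {1..K} \<Longrightarrow>
      \<H>(W \<theta> | (\<lambda>\<omega>. (restrict (\<lambda>n. A \<theta> n \<omega>) {1..N}, restrict (\<lambda>n. Q \<theta> n \<omega>) {1..N}))) = 0"
    and privacy: "n \<in> {1..N} \<Longrightarrow> \<theta> \<in> {1..K} \<Longrightarrow> \<theta>' \<in> {1..K} \<Longrightarrow>
      distr \<Omega> (count_space UNIV) (\<lambda>\<omega>. (Q \<theta> n \<omega>, A \<theta> n \<omega>, stored n \<omega>)) =
      distr \<Omega> (count_space UNIV) (\<lambda>\<omega>. (Q \<theta>' n \<omega>, A \<theta>' n \<omega>, stored n \<omega>))"
begin

definition download_cost :: "nat \<Rightarrow> real" where
  "download_cost \<theta> = (\<Sum>n = 1..N. \<H>(A \<theta> n | Q \<theta> n))"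

text \<open>By privacy, the download cost and the rate do not depend on \<open>\<theta>\<close>.\<close>

definition rate :: "nat \<Rightarrow> real" where
  "rate \<theta> = L / download_cost \<theta>"

end

locale capacity_achieving_sc_pir_scheme = sc_pir_scheme +
  assumes rate_eq_capacity: "\<theta> \<in> {1..K} \<Longrightarrow> rate \<theta> = sc_pir_capacity (\<mu> * N) K"

text \<open>
  The answers of a linear scheme are lists of linear combinations.  The value of \<open>nth_default 0\<close>
  beyond the end of a packet is 0, which is the padding to the length of the
  longest stored packet.
\<close>

context sc_pir_storage
begin

definition max_packet_length :: "nat \<Rightarrow> nat" where
  "max_packet_length n = Max (insert 0 ((\<lambda>(k, i). card (P k i)) ` ({1..K} \<times> I n)))"

definition linear_combination :: "nat \<Rightarrow> (nat \<Rightarrow> nat \<Rightarrow> 'a) \<Rightarrow> 'w \<Rightarrow> 'a list" where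
  "linear_combination n c \<omega> =
    map (\<lambda>t. \<Sum>k = 1..K. \<Sum>i\<in>I n. c k i * nth_default 0 (packet k i \<omega>) t)
      [0..<max_packet_length n]"

end

text \<open>
  The number \<open>len n q\<close> of linear combinations and the coefficients \<open>\<beta> n q j k i\<close> depend on nothing
  but the query \<open>q\<close> to server \<open>n\<close>; in particular not on the desired index, which the
  server does not know.
\<close>

locale linear_sc_pir_scheme = sc_pir_scheme \<Omega> \<mu> N K L F W P I Q A
  for \<Omega> :: "'w measure"
    and \<mu> :: real
    and N :: nat
    and K :: nat
    and L :: nat
    and F :: nat
    and W :: "nat \<Rightarrow> 'w \<Rightarrow> 'a::{field, finite} list"
    and P :: "nat \<Rightarrow> nat \<Rightarrow> nat set"
    and I :: "nat \<Rightarrow> nat set"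
    and Q :: "nat \<Rightarrow> nat \<Rightarrow> 'w \<Rightarrow> 'query"
    and A :: "nat \<Rightarrow> nat \<Rightarrow> 'w \<Rightarrow> 'a list list" +
  assumes linear: "\<exists>len \<beta>. \<forall>\<theta>\<in>{1..K}. \<forall>n\<in>{1..N}. \<forall>\<omega>\<in>space \<Omega>.
      A \<theta> n \<omega> = map (\<lambda>j. linear_combination n (\<beta> n (Q \<theta> n \<omega>) j) \<omega>) [1..<Suc (len n (Q \<theta> n \<omega>))]"

end

theory Submission
  imports Defs
begin

text \<open>
  Split every file into \<open>eta N M\<close> pieces of suitable sizes, each of which is stored by \<open>M\<close> servers, such
  that every server stores a fraction \<open>M / N\<close> of the file; such a splitting is obtained by following
  the recursion of \<open>eta\<close>, which is invariant under scaling of its arguments.  To each piece apply, with independent randomness, the scheme of Tian, Sun and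
  Chen for \<open>M\<close> replicated servers, in which a file has \<open>M - 1\<close> symbols and an additional dummy symbol 0.
  The server at position \<open>p < M\<close> returns the sum over the files \<open>k\<close> of symbol \<open>f\<^sub>k\<close> if \<open>k\<close> is not
  desired, and symbol \<open>f\<^sub>k + p\<close> modulo \<open>M\<close> if it is, where \<open>f\<close> is uniform in \<open>\<int>\<^sub>M\<^sup>K\<close>.  The answers differ only in
  the desired file, whose symbols are all obtained by subtracting the answer that involves the dummy
  symbol.  An answer vanishes if its query is 0, which has probability \<open>1 / M\<^sup>K\<close>, and is uniform otherwise.
  If a file has length \<open>N * (M - 1)\<close>, the lengths of the symbols of the pieces at a server add up to \<open>M\<close>,
  so its answer has entropy \<open>M * (1 - 1 / M\<^sup>K)\<close>, which gives the rate \<open>(M - 1) / (M * (1 - 1 / M\<^sup>K))\<close>, the capacity.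
\<close>

section \<open>Storage designs\<close>

text \<open>Comparisons and differences scale with \<open>g\<close>, so both recursions take the
  same branches. Hence the design can be built for \<open>N\<close> and \<open>M\<close> themselves,
  without passing to the coprime quotients.\<close>

lemma eta_mult:
  assumes "0 < g"
  shows "eta (g * N) (g * M) = eta N M"
proof (induction N M rule: eta.induct)
  case (1 N M)
  have "2 * (g * M) \<le> g * N \<longleftrightarrow> 2 * M \<le> N"
    using assms by (metis mult.left_commute mult_le_cancel1)
  moreover have "g * N - g * M = g * (N - M)" "2 * (g * M) - g * N = g * (2 * M - N)"
    by (simp_all add: diff_mult_distrib2 mult.left_commute)
  ultimately show ?case
    using assms 1 by (simp add: eta.simps [of "g * N"] eta.simps [of N M])
qed

text \<open>
  \<open>S i\<close> is the set of servers that store piece \<open>i\<close> of a file, and \<open>a i / N\<close> is the share of the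
  piece in the file.  For \<open>2 M \<le> N\<close>, a design for \<open>N - M\<close> servers is extended by a piece on
  the \<open>M\<close> new servers.  For \<open>N < 2 M\<close>, the \<open>N - M\<close> new servers store all the pieces of a design for
  \<open>M\<close> servers and a new piece on the old servers makes up for the difference.
\<close>

lemma storage_design:
  assumes "1 \<le> M" "M \<le> N"
  shows "\<exists>(S :: nat \<Rightarrow> nat set) (a :: nat \<Rightarrow> nat).
    (\<forall>i<eta N M. S i \<subseteq> {1..N} \<and> card (S i) = M \<and> 0 < a i) \<and>
    (\<Sum>i<eta N M. a i) = N \<and>
    (\<forall>n\<in>{1..N}. (\<Sum>i<eta N M. if n \<in> S i then a i else 0) = M)"
  using assms
proof (induction N M rule: eta.induct)
  case (1 N M)
  consider "N = M" | "M < N" "2 * M \<le> N" | "M < N" "N < 2 * M"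
    using 1 by linarith
  then show ?case
  proof cases
    case 1
    \<comment> \<open>The recursion ends with a single piece, stored by all servers.\<close>
    then show ?thesis
      using \<open>1 \<le> M\<close> by (intro exI [of _ "\<lambda>_. {1..N}"] exI [of _ "\<lambda>_. N"]) (simp add: eta.simps)
  next
    case 2
    define s where "s = eta (N - M) M"
    have eta: "eta N M = Suc s"
      using 2 \<open>1 \<le> M\<close> by (simp add: eta.simps [of N M] s_def)
    have conds: "\<not> (M = 0 \<or> N \<le> M)" "2 * M \<le> N" "1 \<le> M" "M \<le> N - M"
      using 2 \<open>1 \<le> M\<close> by simp_all
    obtain S and a :: "nat \<Rightarrow> nat" where
      S: "\<And>i. i < s \<Longrightarrow> S i \<subseteq> {1..N - M} \<and> card (S i) = M \<and> 0 < a i"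
      and a: "(\<Sum>i<s. a i) = N - M"
      and M: "\<And>n. n \<in> {1..N - M} \<Longrightarrow> (\<Sum>i<s. if n \<in> S i then a i else 0) = M"
      using 1(1) [OF conds] unfolding s_def by blast
    define S' where "S' i = (if i < s then S i else {N - M + 1..N})" for i
    define a' where "a' i = (if i < s then a i else M)" for i
    have "(\<Sum>i<Suc s. if n \<in> S' i then a' i else 0) = M" if "n \<in> {1..N}" for n
    proof -
      have "(\<Sum>i<s. if n \<in> S' i then a' i else 0) = (\<Sum>i<s. if n \<in> S i then a i else 0)"
        by (intro sum.cong) (simp_all add: S'_def a'_def)
      also have "\<dots> = (if n \<le> N - M then M else 0)"
      proof (cases "n \<le> N - M")
        case False
        then have "n \<notin> S i" if "i < s" for i
          using S [OF that] by auto
        then show ?thesis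
          using False by simp
      qed (use M [of n] that in simp)
      finally show ?thesis
        using that by (simp add: S'_def a'_def)
    qed
    moreover have "S' i \<subseteq> {1..N} \<and> card (S' i) = M \<and> 0 < a' i" if "i < Suc s" for i
    proof (cases "i < s")
      case True
      have "S i \<subseteq> {1..N}"
        by (rule subset_trans [OF conjunct1 [OF S [OF True]]]) auto
      then show ?thesis
        using S [OF True] True by (simp add: S'_def a'_def)
    qed (use \<open>1 \<le> M\<close> 2 in \<open>simp add: S'_def a'_def\<close>)
    moreover have "(\<Sum>i<Suc s. a' i) = N"
      using a 2 by (simp add: a'_def)
    ultimately show ?thesis
      unfolding eta by blast
  next
    case 3
    define s where "s = eta M (2 * M - N)"
    have eta: "eta N M = Suc s"
      using 3 \<open>1 \<le> M\<close> by (simp add: eta.simps [of N M] s_def)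
    have conds: "\<not> (M = 0 \<or> N \<le> M)" "\<not> 2 * M \<le> N" "1 \<le> 2 * M - N" "2 * M - N \<le> M"
      using 3 \<open>1 \<le> M\<close> by auto
    obtain S and a :: "nat \<Rightarrow> nat" where
      S: "\<And>i. i < s \<Longrightarrow> S i \<subseteq> {1..M} \<and> card (S i) = 2 * M - N \<and> 0 < a i"
      and a: "(\<Sum>i<s. a i) = M"
      and M: "\<And>n. n \<in> {1..M} \<Longrightarrow> (\<Sum>i<s. if n \<in> S i then a i else 0) = 2 * M - N"
      using 1(2) [OF conds] unfolding s_def by blast
    define S' where "S' i = (if i < s then S i \<union> {M + 1..N} else {1..M})" for i
    \<comment> \<open>The weight \<open>N - M\<close> raises the load \<open>2 * M - N\<close> of
      every old server to \<open>M\<close>. The new servers store all the old pieces, whose weights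
      already add up to \<open>M\<close>.\<close>
    define a' where "a' i = (if i < s then a i else N - M)" for i
    have "(\<Sum>i<Suc s. if n \<in> S' i then a' i else 0) = M" if "n \<in> {1..N}" for n
    proof -
      have "(\<Sum>i<s. if n \<in> S' i then a' i else 0)
          = (\<Sum>i<s. if n \<in> S i \<or> M < n then a i else 0)"
        using that by (intro sum.cong) (auto simp: S'_def a'_def)
      also have "\<dots> = (if n \<le> M then 2 * M - N else M)"
        using M [of n] a that by simp
      finally show ?thesis
        using that 3 by (simp add: S'_def a'_def)
    qed
    moreover have "S' i \<subseteq> {1..N} \<and> card (S' i) = M \<and> 0 < a' i" if "i < Suc s" for i
    proof (cases "i < s")
      case True
      have "S i \<inter> {M + 1..N} = {}" "finite (S i)"
        using S [OF True] by (auto intro: finite_subset)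
      then have "card (S i \<union> {M + 1..N}) = M"
        using S [OF True] 3 by (subst card_Un_disjoint) auto
      moreover have "S i \<subseteq> {1..N}"
        by (rule subset_trans [OF conjunct1 [OF S [OF True]]]) (use 3 in auto)
      ultimately show ?thesis
        using S [OF True] True by (auto simp: S'_def a'_def)
    next
      case False
      then show ?thesis
        using 3 by (auto simp: S'_def a'_def)
    qed
    moreover have "(\<Sum>i<Suc s. a' i) = N"
      using a 3 by (simp add: a'_def)
    ultimately show ?thesis
      unfolding eta by blast
  qed
qed

section \<open>Counting and intervals\<close>

text \<open>Equation \<open>d\<close> can be solved for the coordinate \<open>c d\<close>, which occurs in no other equation.\<close>

lemma card_PiE_pivots:
  fixes h :: "'d \<Rightarrow> ('c \<Rightarrow> 'a::{ab_group_add, finite}) \<Rightarrow> 'a"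
  assumes "finite C" and c: "inj_on c D" "c ` D \<subseteq> C"
    and h: "\<And>d v v'. d \<in> D \<Longrightarrow> (\<And>e. e \<in> C - c ` D \<Longrightarrow> v e = v' e) \<Longrightarrow> h d v = h d v'"
  shows "card {v \<in> C \<rightarrow>\<^sub>E UNIV. \<forall>d\<in>D. v (c d) + h d v = x d} * CARD('a) ^ card D
    = CARD('a) ^ card C"
proof -
  let ?V = "{v \<in> C \<rightarrow>\<^sub>E UNIV. \<forall>d\<in>D. v (c d) + h d v = x d}"
  let ?U = "C - c ` D \<rightarrow>\<^sub>E (UNIV :: 'a set)"
  \<comment> \<open>\<open>g\<close> inverts the restriction to the non-pivot coordinates: it solves
    equation \<open>d\<close> for the coordinate \<open>c d\<close>.\<close>
  define g where "g u = (\<lambda>e\<in>C. if e \<in> c ` D then x (the_inv_into D c e) - h (the_inv_into D c e) u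
    else u e)" for u
  have hg: "h d (g u) = h d u" if "d \<in> D" for d u
    by (intro h that) (simp add: g_def)
  have hr: "h d (restrict v (C - c ` D)) = h d v" if "d \<in> D" for d v
    by (intro h that) simp
  have "bij_betw (\<lambda>v. restrict v (C - c ` D)) ?V ?U"
  proof (intro bij_betw_byWitness [where f' = g] ballI)
    fix v assume v: "v \<in> ?V"
    show "g (restrict v (C - c ` D)) = v"
    proof (rule ext)
      fix e show "g (restrict v (C - c ` D)) e = v e"
      proof (cases "e \<in> c ` D")
        case True
        then obtain d where "d \<in> D" "e = c d" by blast
        then show ?thesis
          using v c by (force simp: g_def the_inv_into_f_f hr algebra_simps)
      next
        case False
        then show ?thesis
          using v PiE_arb [of v C "\<lambda>_. UNIV" e] by (cases "e \<in> C") (simp_all add: g_def)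
      qed
    qed
  next
    fix u assume u: "u \<in> ?U"
    show "restrict (g u) (C - c ` D) = u"
    proof (rule ext)
      fix e show "restrict (g u) (C - c ` D) e = u e"
        using PiE_arb [OF u, of e] by (cases "e \<in> C - c ` D") (auto simp: g_def)
    qed
  next
    show "(\<lambda>v. restrict v (C - c ` D)) ` ?V \<subseteq> ?U"
      by auto
  next
    show "g ` ?U \<subseteq> ?V"
    proof (intro image_subsetI CollectI conjI ballI)
      fix u d assume "d \<in> D"
      then show "g u (c d) + h d (g u) = x d"
        unfolding hg [OF \<open>d \<in> D\<close>] using c by (auto simp: g_def the_inv_into_f_f)
    qed (simp add: g_def)
  qed
  then have "card ?V = card ?U"
    by (rule bij_betw_same_card)
  also have "\<dots> = CARD('a) ^ (card C - card D)"
    using assms by (simp add: card_PiE card_Diff_subset card_image finite_subset)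
  finally show ?thesis
    using assms by (metis card_image card_mono le_add_diff_inverse2 power_add)
qed

lemma disjoint_consecutive_intervals:
  fixes f :: "nat \<Rightarrow> nat"
  assumes "mono f"
  shows "disjoint_family_on (\<lambda>i. {f (i - 1)..<f i}) {1..n}"
  unfolding disjoint_family_on_def
proof (intro ballI impI)
  fix i j assume "i \<in> {1..n}" "j \<in> {1..n}" "i \<noteq> j"
  then have "i \<le> j - 1 \<or> j \<le> i - 1"
    by auto
  then have "f i \<le> f (j - 1) \<or> f j \<le> f (i - 1)"
    using monoD [OF assms] by blast
  then show "{f (i - 1)..<f i} \<inter> {f (j - 1)..<f j} = {}"
    by auto
qed

lemma UN_consecutive_intervals:
  fixes f :: "nat \<Rightarrow> nat"
  assumes "mono f" and "f 0 = 0"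
  shows "(\<Union>i\<in>{1..n}. {f (i - 1)..<f i}) = {..<f n}"
proof (induction n)
  case (Suc n)
  have "f n \<le> f (Suc n)"
    using assms by (simp add: monoD)
  then show ?case
    using Suc by (auto simp: atLeastAtMostSuc_conv)
qed (use assms in simp)

lemma nths_eq_Nil: "(\<And>i. i < length xs \<Longrightarrow> i \<notin> A) \<Longrightarrow> nths xs A = []"
  by (auto simp: nths_def filter_empty_conv set_zip)

lemma nths_atLeastLessThan: "nths xs {m..<n} = take (n - m) (drop m xs)"
proof -
  have "nths xs {m..<n} = nths (take m xs @ drop m xs) {m..<n}"
    by simp
  also have "\<dots> = nths (drop m xs) {j. j + length (take m xs) \<in> {m..<n}}"
    using nths_eq_Nil [of "take m xs" "{m..<n}"] by (subst nths_append) simp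
  also have "\<dots> = nths (drop m xs) {..<n - m}"
  proof (cases "m \<le> length xs")
    case True
    then have "{j. j + length (take m xs) \<in> {m..<n}} = {..<n - m}"
      by auto
    then show ?thesis by simp
  qed simp
  finally show ?thesis by simp
qed

lemma finite_vectors: "finite (vectors L :: 'a::finite list set)"
  and card_vectors: "card (vectors L :: 'a list set) = CARD('a) ^ L"
  using finite_lists_length_eq [of "UNIV :: 'a set" L] card_lists_length_eq [of "UNIV :: 'a set" L]
  by (simp_all add: vectors_def)

text \<open>Identifies families of vectors with functions on pairs of a file and a coordinate, the
  form in which \<open>card_PiE_pivots\<close> counts solutions.\<close>

lemma bij_betw_vectors:
  "bij_betw (\<lambda>v. \<lambda>k\<in>A. map (\<lambda>t. v (k, t)) [0..<L]) (A \<times> {..<L} \<rightarrow>\<^sub>E UNIV) (A \<rightarrow>\<^sub>E vectors L)"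
proof (intro bij_betw_byWitness [where f' = "\<lambda>w. \<lambda>(k, t)\<in>A \<times> {..<L}. w k ! t"] ballI)
  fix w assume "w \<in> A \<rightarrow>\<^sub>E vectors L"
  then show "(\<lambda>k\<in>A. map (\<lambda>t. (\<lambda>(k, t)\<in>A \<times> {..<L}. w k ! t) (k, t)) [0..<L]) = w"
    by (intro ext) (auto simp: vectors_def PiE_iff extensional_def intro!: nth_equalityI)
next
  fix v :: "_ \<times> nat \<Rightarrow> 'b" assume "v \<in> A \<times> {..<L} \<rightarrow>\<^sub>E UNIV"
  then show "(\<lambda>(k, t)\<in>A \<times> {..<L}. (\<lambda>k\<in>A. map (\<lambda>t. v (k, t)) [0..<L]) k ! t) = v"
    by (auto simp: fun_eq_iff PiE_iff extensional_def)
qed (auto simp: vectors_def split: if_splits)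

section \<open>Entropy on uniform finite sample spaces\<close>

text \<open>On such a space every function is simple and probabilities are relative cardinalities,
  so statements on entropies reduce to counting fibres.\<close>

locale uniform_information_space =
  fixes \<Omega> :: "'w set" and b :: real
  assumes finite_sample: "finite \<Omega>" and nonempty_sample: "\<Omega> \<noteq> {}" and base_gt_1: "1 < b"
begin

sublocale information_space "uniform_count_measure \<Omega>" b
proof -
  interpret prob_space "uniform_count_measure \<Omega>"
    by (rule prob_space_uniform_count_measure [OF finite_sample nonempty_sample])
  show "information_space (uniform_count_measure \<Omega>) b"
    by standard (rule base_gt_1)
qed

notation entropy_Pow (\<open>\<H>'(_')\<close>)
notation mutual_information_Pow (\<open>\<I>'(_ ; _')\<close>)
notation conditional_entropy_Pow (\<open>\<H>'(_ | _')\<close>)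

lemma space_uniform [simp]: "space (uniform_count_measure \<Omega>) = \<Omega>"
  by (rule space_uniform_count_measure)

lemma measurable_uniform [simp]:
  "f \<in> uniform_count_measure \<Omega> \<rightarrow>\<^sub>M T \<longleftrightarrow> f \<in> \<Omega> \<rightarrow> space T"
  by (simp add: measurable_cong_sets [OF sets_uniform_count_measure_count_space refl])

lemma simple_function_uniform [simp]: "simple_function (uniform_count_measure \<Omega>) X"
  using finite_sample by (simp add: simple_function_def sets_uniform_count_measure)

lemma prob_eq: "B \<subseteq> \<Omega> \<Longrightarrow> prob B = card B / card \<Omega>"
  by (rule measure_uniform_count_measure [OF finite_sample])

lemma simple_distributed_uniform:
  "simple_distributed (uniform_count_measure \<Omega>) X (\<lambda>x. card {\<omega> \<in> \<Omega>. X \<omega> = x} / card \<Omega>)"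
proof (rule simple_distributedI)
  fix x
  have "X -` {x} \<inter> \<Omega> = {\<omega> \<in> \<Omega>. X \<omega> = x}"
    by blast
  then show "card {\<omega> \<in> \<Omega>. X \<omega> = x} / card \<Omega> = prob (X -` {x} \<inter> space (uniform_count_measure \<Omega>))"
    by (simp add: prob_eq)
qed simp_all

text \<open>Given \<open>Y = y\<close>, every value that \<open>X\<close> attains has conditional
  probability \<open>1 / b ^ d y\<close>, so the conditional entropy is the mean of
  \<open>d\<close>. The exponent may vary with \<open>y\<close> because the amount of information in
  an answer depends on the query.\<close>

lemma conditional_entropy_uniform_fibres:
  assumes fibres: "\<And>\<omega>. \<omega> \<in> \<Omega> \<Longrightarrow>
    real (card {\<omega>' \<in> \<Omega>. X \<omega>' = X \<omega> \<and> Y \<omega>' = Y \<omega>}) * b ^ d (Y \<omega>) = card {\<omega>' \<in> \<Omega>. Y \<omega>' = Y \<omega>}"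
  shows "\<H>(X | Y) = (\<Sum>\<omega>\<in>\<Omega>. real (d (Y \<omega>))) / card \<Omega>"
proof -
  let ?XY = "\<lambda>\<omega>. (X \<omega>, Y \<omega>)"
  let ?Pxy = "\<lambda>z. card {\<omega> \<in> \<Omega>. ?XY \<omega> = z} / card \<Omega>"
  let ?Py = "\<lambda>y. card {\<omega> \<in> \<Omega>. Y \<omega> = y} / card \<Omega>"
  have card_pos: "0 < card \<Omega>"
    using finite_sample nonempty_sample by (simp add: card_gt_0_iff)
  have log: "log b (?Pxy (?XY \<omega>) / ?Py (Y \<omega>)) = - real (d (Y \<omega>))" if "\<omega> \<in> \<Omega>" for \<omega>
  proof -
    have "0 < card {\<omega>' \<in> \<Omega>. ?XY \<omega>' = ?XY \<omega>}"
      using finite_sample that by (auto simp: card_gt_0_iff)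
    then have "?Pxy (?XY \<omega>) / ?Py (Y \<omega>) = inverse (b ^ d (Y \<omega>))"
      using fibres [OF that, symmetric] card_pos base_gt_1 by (simp add: field_simps)
    also have "\<dots> = b powr (- real (d (Y \<omega>)))"
      using base_gt_1 by (simp add: powr_minus powr_realpow)
    finally show ?thesis
      using base_gt_1 by simp
  qed
  have "\<H>(X | Y) = - (\<Sum>(x, y)\<in>?XY ` \<Omega>. ?Pxy (x, y) * log b (?Pxy (x, y) / ?Py y))"
    using conditional_entropy_eq [OF simple_distributed_uniform [of Y] simple_distributed_uniform [of ?XY]]
    by (simp only: space_uniform)
  also have "\<dots> = (\<Sum>z\<in>?XY ` \<Omega>. ?Pxy z * d (snd z))"
    unfolding sum_negf [symmetric]
  proof (intro sum.cong refl)
    fix z assume "z \<in> ?XY ` \<Omega>"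
    then obtain \<omega> where "\<omega> \<in> \<Omega>" "z = ?XY \<omega>" by blast
    then show "- (case z of (x, y) \<Rightarrow> ?Pxy (x, y) * log b (?Pxy (x, y) / ?Py y)) = ?Pxy z * d (snd z)"
      using log by simp
  qed
  \<comment> \<open>Each term is spread evenly over its fibre, which turns the sum over values into
    a sum over sample points.\<close>
  also have "\<dots> = (\<Sum>z\<in>?XY ` \<Omega>. \<Sum>\<omega>\<in>{\<omega> \<in> \<Omega>. ?XY \<omega> = z}. d (Y \<omega>) / card \<Omega>)"
  proof (intro sum.cong refl)
    fix z
    have "(\<Sum>\<omega>\<in>{\<omega> \<in> \<Omega>. ?XY \<omega> = z}. d (Y \<omega>) / card \<Omega>)
        = (\<Sum>\<omega>\<in>{\<omega> \<in> \<Omega>. ?XY \<omega> = z}. d (snd z) / card \<Omega>)"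
      by (intro sum.cong) auto
    then show "?Pxy z * d (snd z) = (\<Sum>\<omega>\<in>{\<omega> \<in> \<Omega>. ?XY \<omega> = z}. d (Y \<omega>) / card \<Omega>)"
      by simp
  qed
  also have "\<dots> = (\<Sum>\<omega>\<in>\<Omega>. d (Y \<omega>) / card \<Omega>)"
    by (rule sum.image_gen [OF finite_sample, symmetric])
  finally show ?thesis
    by (simp add: sum_divide_distrib)
qed

lemma conditional_entropy_eq_0:
  assumes "\<And>\<omega> \<omega>'. \<omega> \<in> \<Omega> \<Longrightarrow> \<omega>' \<in> \<Omega> \<Longrightarrow> Y \<omega> = Y \<omega>' \<Longrightarrow> X \<omega> = X \<omega>'"
  shows "\<H>(X | Y) = 0"
proof -
  have "card {\<omega>' \<in> \<Omega>. X \<omega>' = X \<omega> \<and> Y \<omega>' = Y \<omega>} = card {\<omega>' \<in> \<Omega>. Y \<omega>' = Y \<omega>}"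
    if "\<omega> \<in> \<Omega>" for \<omega>
    using assms that by (intro arg_cong [where f = card]) blast
  then show ?thesis
    using conditional_entropy_uniform_fibres [of X Y "\<lambda>_. 0"] by simp
qed

lemma entropy_le_log_card:
  assumes "finite B" "X ` \<Omega> \<subseteq> B"
  shows "\<H>(X) \<le> log b (card B)"
proof -
  have "\<H>(X) \<le> log b (card (X ` \<Omega>))"
    using entropy_le_card [OF simple_distributed_uniform] by simp
  also have "\<dots> \<le> log b (card B)"
  proof -
    have "0 < card (X ` \<Omega>)"
      using finite_sample nonempty_sample by (simp add: card_gt_0_iff)
    then show ?thesis
      using base_gt_1 card_mono [OF assms] by simp
  qed
  finally show ?thesis .
qed

lemma entropy_eqI:
  assumes "X ` \<Omega> = Y ` \<Omega>" and "\<And>x. card {\<omega> \<in> \<Omega>. X \<omega> = x} = card {\<omega> \<in> \<Omega>. Y \<omega> = x}"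
  shows "\<H>(X) = \<H>(Y)"
  using assms entropy_simple_distributed [OF simple_distributed_uniform, of X]
    entropy_simple_distributed [OF simple_distributed_uniform, of Y] by simp

text \<open>A permutation of the sample space preserves the uniform measure. Privacy is thereby
  reduced to a permutation that turns the view of a server for one desired file into its view for
  another.\<close>

lemma distr_uniform_eqI:
  assumes "bij_betw \<phi> \<Omega> \<Omega>" and "\<And>\<omega>. \<omega> \<in> \<Omega> \<Longrightarrow> f \<omega> = g (\<phi> \<omega>)"
  shows "distr (uniform_count_measure \<Omega>) (count_space UNIV) f =
    distr (uniform_count_measure \<Omega>) (count_space UNIV) g"
proof (rule measure_eqI)
  fix B
  have "bij_betw \<phi> (f -` B \<inter> \<Omega>) (g -` B \<inter> \<Omega>)"
    unfolding bij_betw_def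
  proof
    show "inj_on \<phi> (f -` B \<inter> \<Omega>)"
      using assms(1) by (auto simp: bij_betw_def intro: inj_on_subset)
    show "\<phi> ` (f -` B \<inter> \<Omega>) = g -` B \<inter> \<Omega>"
    proof (intro equalityI subsetI)
      fix \<omega>' assume \<omega>': "\<omega>' \<in> g -` B \<inter> \<Omega>"
      then obtain \<omega> where "\<omega> \<in> \<Omega>" "\<omega>' = \<phi> \<omega>"
        using bij_betw_imp_surj_on [OF assms(1)] by blast
      then show "\<omega>' \<in> \<phi> ` (f -` B \<inter> \<Omega>)"
        using \<omega>' assms(2) by (intro image_eqI) auto
    qed (use assms(2) bij_betwE [OF assms(1)] in auto)
  qed
  then have "card (f -` B \<inter> \<Omega>) = card (g -` B \<inter> \<Omega>)"
    by (rule bij_betw_same_card)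
  then show "emeasure (distr (uniform_count_measure \<Omega>) (count_space UNIV) f) B =
      emeasure (distr (uniform_count_measure \<Omega>) (count_space UNIV) g) B"
    by (simp add: emeasure_distr emeasure_uniform_count_measure [OF finite_sample])
qed simp

end

section \<open>The scheme of a storage design\<close>

lemma card_Collect_bij_betw:
  assumes "bij_betw f A B"
  shows "card {y \<in> B. P y} = card {x \<in> A. P (f x)}"
proof -
  have "{y \<in> B. P y} = f ` {x \<in> A. P (f x)}"
    using bij_betw_imp_surj_on [OF assms] by blast
  moreover have "inj_on f {x \<in> A. P (f x)}"
    using assms by (auto simp: bij_betw_def intro: inj_on_subset)
  ultimately show ?thesis
    by (simp add: card_image)
qed

lemma card_Times_Collect:
  "card {z \<in> A \<times> B. P (fst z) \<and> Q (snd z)} = card {x \<in> A. P x} * card {y \<in> B. Q y}"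
proof -
  have "{z \<in> A \<times> B. P (fst z) \<and> Q (snd z)} = {x \<in> A. P x} \<times> {y \<in> B. Q y}"
    by auto
  then show ?thesis
    by (simp add: card_cartesian_product)
qed

lemma add_mod_right_cancel:
  fixes x y p M :: nat
  assumes "x < M" "y < M" "(x + p) mod M = (y + p) mod M"
  shows "x = y"
  using assms
proof (induction x y rule: linorder_wlog)
  case (le x y)
  then have "M dvd (y + p) - (x + p)"
    by (metis add_le_mono1 mod_eq_dvd_iff_nat)
  with le show ?case
    by (auto dest: dvd_imp_le)
qed simp

text \<open>Used for the \<open>M - 1\<close> consecutive packets of a piece, which all have the
  weight of the piece.\<close>

lemma sum_div_lessThan: "(\<Sum>g<s * m. h (g div m)) = m * (\<Sum>i<s. h i)" for h :: "nat \<Rightarrow> nat"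
proof -
  have "(\<Sum>g<s * m. h (g div m)) = (\<Sum>i<s. \<Sum>g=i * m..<i * m + m. h (g div m))"
    by (rule sum.nat_group [symmetric])
  also have "\<dots> = (\<Sum>i<s. \<Sum>g=i * m..<i * m + m. h i)"
    by (intro sum.cong refl arg_cong [where f = h]) (auto intro!: div_nat_eqI simp: mult.commute)
  finally show ?thesis
    by (simp add: sum_distrib_left)
qed

text \<open>\<open>scalar\<close> fixes the type of the field. \<open>pos i\<close> numbers the
  servers that store piece \<open>i\<close>, which identifies them with the residues modulo
  \<open>M\<close>.\<close>

locale pir_design =
  fixes scalar :: "'a::{field, finite} itself"
    and N K M s :: nat and S :: "nat \<Rightarrow> nat set" and a :: "nat \<Rightarrow> nat" and pos :: "nat \<Rightarrow> nat \<Rightarrow> nat"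
  assumes K_pos: "1 \<le> K" and M_ge_2: "2 \<le> M" and M_le_N: "M \<le> N"
    and S_subset: "i < s \<Longrightarrow> S i \<subseteq> {1..N}"
    and pos: "i < s \<Longrightarrow> bij_betw (pos i) (S i) {..<M}"
    and a_pos: "i < s \<Longrightarrow> 0 < a i"
    and sum_a: "(\<Sum>i<s. a i) = N"
    and load: "n \<in> {1..N} \<Longrightarrow> (\<Sum>i<s. if n \<in> S i then a i else 0) = M"
begin

text \<open>
  Packets are numbered from 1.  Packets \<open>i * (M - 1) + c\<close> with \<open>c \<in> {1..<M}\<close> make up piece \<open>i\<close> and
  have length \<open>a i\<close>.  They are the symbols \<open>c\<close> of a file in the scheme for this piece; \<open>c = 0\<close> is the
  dummy symbol.
\<close>

definition file_length :: nat where
  "file_length = N * (M - 1)"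

definition piece :: "nat \<Rightarrow> nat" where
  "piece f = (f - 1) div (M - 1)"

text \<open>The packets fill a file from left to right, and packet \<open>g + 1\<close> has length
  \<open>a (g div (M - 1))\<close>. All files are cut in the same way.\<close>

definition packet_end :: "nat \<Rightarrow> nat" where
  "packet_end f = (\<Sum>g<f. a (g div (M - 1)))"

definition coords :: "nat \<Rightarrow> nat \<Rightarrow> nat set" where
  "coords k f = {packet_end (f - 1)..<packet_end f}"

definition storage :: "nat \<Rightarrow> nat set" where
  "storage n = {f \<in> {1..s * (M - 1)}. n \<in> S (piece f)}"

definition index :: "nat \<Rightarrow> nat \<Rightarrow> nat" where
  "index i c = i * (M - 1) + c"

text \<open>The value 0 stands for the dummy symbol if \<open>c = 0\<close>, and for the
  zero-padding of a short packet if \<open>t\<close> is at least \<open>a i\<close>.\<close>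

definition symb :: "nat \<Rightarrow> nat \<Rightarrow> nat \<Rightarrow> 'a list \<Rightarrow> 'a" where
  "symb i c t w = (if c \<noteq> 0 \<and> t < a i then w ! (packet_end (index i c - 1) + t) else 0)"

section \<open>Layout of the packets in a file\<close>

lemma file_length_pos: "1 \<le> file_length"
  using M_ge_2 M_le_N by (simp add: file_length_def)

lemma packet_end_simps: "packet_end 0 = 0" "packet_end (Suc f) = packet_end f + a (f div (M - 1))"
  by (simp_all add: packet_end_def)

lemma packet_end_step: "1 \<le> f \<Longrightarrow> packet_end f = packet_end (f - 1) + a (piece f)"
  by (cases f) (simp_all add: packet_end_simps piece_def)

lemma mono_packet_end: "mono packet_end"
  by (rule monoI) (auto simp: packet_end_def intro!: sum_mono2)

lemma packet_end_total: "packet_end (s * (M - 1)) = file_length"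
  by (simp add: packet_end_def sum_div_lessThan sum_a file_length_def)

lemma packet_end_le: "f \<le> s * (M - 1) \<Longrightarrow> packet_end f \<le> file_length"
  using monoD [OF mono_packet_end] packet_end_total by metis

lemma piece_less: "f \<in> {1..s * (M - 1)} \<Longrightarrow> piece f < s"
  using M_ge_2 by (auto simp: piece_def less_mult_imp_div_less)

lemma piece_index: "c \<noteq> 0 \<Longrightarrow> c < M \<Longrightarrow> piece (index i c) = i"
proof -
  assume c: "c \<noteq> 0" "c < M"
  then have "index i c - 1 = (c - 1) + i * (M - 1)"
    by (simp add: index_def)
  then show ?thesis
    using c unfolding piece_def by (simp only: div_mult_self1) simp
qed

lemma index_in: "i < s \<Longrightarrow> c \<noteq> 0 \<Longrightarrow> c < M \<Longrightarrow> index i c \<in> {1..s * (M - 1)}"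
proof -
  assume "i < s" "c \<noteq> 0" "c < M"
  then have "index i c \<le> Suc i * (M - 1)"
    by (simp add: index_def)
  also have "\<dots> \<le> s * (M - 1)"
    using \<open>i < s\<close> by (intro mult_le_mono1) simp
  finally show ?thesis
    using \<open>c \<noteq> 0\<close> by (simp add: index_def)
qed

lemma index_surj:
  assumes "1 \<le> f"
  obtains c where "c \<noteq> 0" "c < M" "f = index (piece f) c"
proof
  have "(f - 1) mod (M - 1) < M - 1"
    using M_ge_2 by simp
  then show "Suc ((f - 1) mod (M - 1)) < M"
    by simp
  have "f - 1 = (f - 1) div (M - 1) * (M - 1) + (f - 1) mod (M - 1)"
    by (rule div_mult_mod_eq [symmetric])
  then show "f = index (piece f) (Suc ((f - 1) mod (M - 1)))"
    using assms unfolding index_def piece_def by linarith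
qed simp

lemma symbol_coordinate:
  assumes "i < s" "c \<noteq> 0" "c < M" "t < a i"
  shows "packet_end (index i c - 1) + t \<in> coords k (index i c)"
    and "packet_end (index i c - 1) + t < file_length"
proof -
  have f: "index i c \<in> {1..s * (M - 1)}" "piece (index i c) = i"
    by (rule index_in piece_index; use assms in blast)+
  then show "packet_end (index i c - 1) + t \<in> coords k (index i c)"
    using assms by (simp add: coords_def packet_end_step)
  then show "packet_end (index i c - 1) + t < file_length"
    using f packet_end_le [of "index i c"] by (simp add: coords_def)
qed

lemma disjoint_coords: "disjoint_family_on (coords k) {1..s * (M - 1)}"
  unfolding coords_def by (rule disjoint_consecutive_intervals [OF mono_packet_end])

lemma UN_coords: "(\<Union>f\<in>{1..s * (M - 1)}. coords k f) = {..<file_length}"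
  unfolding coords_def
  using UN_consecutive_intervals [OF mono_packet_end packet_end_simps(1)] packet_end_total by simp

text \<open>Different packets occupy disjoint sets of coordinates. In the count of responses this
  keeps the unknowns of different equations apart.\<close>

lemma symbol_coordinate_inj:
  assumes "i < s" "c \<noteq> 0" "c < M" "t < a i" "i' < s" "c' \<noteq> 0" "c' < M" "t' < a i'"
    and eq: "packet_end (index i c - 1) + t = packet_end (index i' c' - 1) + t'"
  shows "i = i'" "t = t'"
proof -
  have "index i c = index i' c'"
  proof (rule ccontr)
    assume "index i c \<noteq> index i' c'"
    moreover have "index i c \<in> {1..s * (M - 1)}" "index i' c' \<in> {1..s * (M - 1)}"
      by (rule index_in; use assms in blast)+
    ultimately have "coords 0 (index i c) \<inter> coords 0 (index i' c') = {}"
      using disjoint_coords unfolding disjoint_family_on_def by blast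
    then show False
      using symbol_coordinate(1) [of i c t 0] symbol_coordinate(1) [of i' c' t' 0] assms by auto
  qed
  with eq assms show "i = i'" "t = t'"
    by (metis piece_index, simp)
qed

text \<open>The packets cover the file, so its symbols other than the dummy determine it.\<close>

lemma vectors_eqI:
  assumes "w \<in> vectors file_length" "w' \<in> vectors file_length"
    and eq: "\<And>i c t. i < s \<Longrightarrow> c \<noteq> 0 \<Longrightarrow> c < M \<Longrightarrow> t < a i \<Longrightarrow> symb i c t w = symb i c t w'"
  shows "w = w'"
proof (rule nth_equalityI)
  fix x assume "x < length w"
  then have "x \<in> (\<Union>f\<in>{1..s * (M - 1)}. coords 0 f)"
    unfolding UN_coords using assms by (simp add: vectors_def)
  then obtain f where f: "f \<in> {1..s * (M - 1)}" "x \<in> coords 0 f"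
    by blast
  then obtain c where c: "c \<noteq> 0" "c < M" "f = index (piece f) c"
    using index_surj [of f] by auto
  have "x - packet_end (f - 1) < a (piece f)" "packet_end (f - 1) + (x - packet_end (f - 1)) = x"
    using f packet_end_step [of f] by (auto simp: coords_def)
  then show "w ! x = w' ! x"
    using eq [of "piece f" c "x - packet_end (f - 1)"] piece_less f c by (simp add: symb_def)
qed (use assms in \<open>simp add: vectors_def\<close>)

section \<open>Sample space, keys and queries\<close>

definition files :: "(nat \<Rightarrow> 'a list) set" where
  "files = {1..K} \<rightarrow>\<^sub>E vectors file_length"

text \<open>
  A key has a vector of \<open>\<int>\<^sub>M\<^sup>K\<close> for every piece.  The query to a server is the key with the position of
  the server among those that store the piece added to the entry of the desired file, so that it is
  uniformly distributed whatever file is desired.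
\<close>

definition keys :: "(nat \<times> nat \<Rightarrow> nat) set" where
  "keys = {..<s} \<times> {1..K} \<rightarrow>\<^sub>E {..<M}"

text \<open>Keys and queries are represented by natural numbers, as the types in the theorem
  demand.\<close>

definition encode :: "(nat \<times> nat \<Rightarrow> nat) \<Rightarrow> nat" where
  "encode = to_nat_on keys"

text \<open>\<open>from_nat_into\<close> yields a key for every number, even for one that encodes
  none, so facts on decoded queries need no assumption on the query.\<close>

definition decode :: "nat \<Rightarrow> nat \<times> nat \<Rightarrow> nat" where
  "decode = from_nat_into keys"

definition samples :: "((nat \<Rightarrow> 'a list) \<times> nat) set" where
  "samples = files \<times> encode ` keys"

definition sample_file :: "nat \<Rightarrow> (nat \<Rightarrow> 'a list) \<times> nat \<Rightarrow> 'a list" where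
  "sample_file k \<omega> = fst \<omega> k"

definition shift :: "nat \<Rightarrow> nat \<Rightarrow> (nat \<times> nat \<Rightarrow> nat) \<Rightarrow> nat \<times> nat \<Rightarrow> nat" where
  "shift \<theta> n f = (\<lambda>(i, k)\<in>{..<s} \<times> {1..K}. (f (i, k) + (if k = \<theta> then pos i n else 0)) mod M)"

definition query :: "nat \<Rightarrow> nat \<Rightarrow> (nat \<Rightarrow> 'a list) \<times> nat \<Rightarrow> nat" where
  "query \<theta> n \<omega> = encode (shift \<theta> n (decode (snd \<omega>)))"

text \<open>Combinations are numbered from 1 and pieces from 0, so combination \<open>j\<close>
  serves piece \<open>j - 1\<close>. An entry 0 of the query selects the dummy symbol and makes the
  coefficients of that file vanish.\<close>

definition coeff :: "nat \<Rightarrow> nat \<Rightarrow> nat \<Rightarrow> nat \<Rightarrow> nat \<Rightarrow> 'a" where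
  "coeff n q j k f = of_bool (decode q (j - 1, k) \<noteq> 0 \<and> f = index (j - 1) (decode q (j - 1, k)))"

text \<open>Every server returns one combination for each piece. For a piece that it does not store
  the combination is 0 and carries no entropy.\<close>

definition answer :: "nat \<Rightarrow> nat \<Rightarrow> (nat \<Rightarrow> 'a list) \<times> nat \<Rightarrow> 'a list list" where
  "answer \<theta> n \<omega> = map (\<lambda>j. sc_pir_storage.linear_combination K sample_file coords storage n
    (coeff n (query \<theta> n \<omega>) j) \<omega>) [1..<Suc s]"

lemma finite_files: "finite files" and card_files: "card files = CARD('a) ^ (K * file_length)"
  by (simp_all add: files_def finite_PiE finite_vectors card_PiE card_vectors power_mult [symmetric] mult.commute)

lemma finite_keys: "finite keys" and keys_nonempty: "keys \<noteq> {}"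
  using M_ge_2 by (simp_all add: keys_def finite_PiE PiE_eq_empty_iff lessThan_empty_iff)

lemma files_nonempty: "files \<noteq> {}"
  using card_files by (metis card.empty zero_less_card_finite zero_less_power less_not_refl)

lemma decode_encode: "f \<in> keys \<Longrightarrow> decode (encode f) = f"
  unfolding decode_def encode_def by (simp add: countable_finite finite_keys)

lemma inj_on_encode: "inj_on encode keys"
  by (metis decode_encode inj_on_inverseI)

lemma decode_in_keys: "decode q \<in> keys"
  unfolding decode_def using keys_nonempty by (rule from_nat_into)

text \<open>Adding a constant modulo \<open>M\<close> is injective, and an injective map of a finite
  set to itself is onto. So a query is as uniform as the key, whatever file is desired.\<close>

lemma bij_betw_shift: "bij_betw (shift \<theta> n) keys keys"
proof -
  have maps: "shift \<theta> n ` keys \<subseteq> keys"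
    unfolding shift_def keys_def image_subset_iff restrict_PiE_iff using M_ge_2 by auto
  moreover have "inj_on (shift \<theta> n) keys"
  proof (rule inj_onI)
    fix f g assume fg: "f \<in> keys" "g \<in> keys" "shift \<theta> n f = shift \<theta> n g"
    show "f = g"
    proof (rule PiE_ext [OF fg(1,2) [unfolded keys_def]])
      fix z assume z: "z \<in> {..<s} \<times> {1..K}"
      then obtain i k where ik: "z = (i, k)" by force
      have "f z < M" "g z < M"
        using fg z by (auto simp: keys_def)
      moreover have "(f z + (if k = \<theta> then pos i n else 0)) mod M
          = (g z + (if k = \<theta> then pos i n else 0)) mod M"
        using fun_cong [OF fg(3), of z] z unfolding ik shift_def by simp
      ultimately show "f z = g z"
        by (rule add_mod_right_cancel)
    qed
  qed
  ultimately show ?thesis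
    using endo_inj_surj [OF finite_keys] by (simp add: bij_betw_def)
qed

lemma shift_in_keys: "f \<in> keys \<Longrightarrow> shift \<theta> n f \<in> keys"
  using bij_betwE [OF bij_betw_shift] by blast

lemma decode_query: "decode (query \<theta> n \<omega>) = shift \<theta> n (decode (snd \<omega>))"
  by (simp add: query_def decode_encode shift_in_keys decode_in_keys)

text \<open>Conditioning on the query to one server amounts to conditioning on the whole
  key.\<close>

lemma query_eq_iff:
  assumes "\<omega> \<in> samples" "\<omega>' \<in> samples"
  shows "query \<theta> n \<omega> = query \<theta> n \<omega>' \<longleftrightarrow> snd \<omega> = snd \<omega>'"
proof
  assume "query \<theta> n \<omega> = query \<theta> n \<omega>'"
  then have "shift \<theta> n (decode (snd \<omega>)) = shift \<theta> n (decode (snd \<omega>'))"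
    by (metis decode_query)
  then have "decode (snd \<omega>) = decode (snd \<omega>')"
    using bij_betw_imp_inj_on [OF bij_betw_shift] decode_in_keys by (metis inj_onD)
  then show "snd \<omega> = snd \<omega>'"
    using assms by (auto simp: samples_def decode_encode)
qed (simp add: query_def)

sublocale uniform_information_space samples "real CARD('a)"
proof
  show "finite samples" "samples \<noteq> {}"
    using finite_files finite_keys files_nonempty keys_nonempty by (simp_all add: samples_def)
  have "card {0, 1 :: 'a} \<le> CARD('a)"
    by (rule card_mono) simp_all
  then show "1 < real CARD('a)"
    by simp
qed

section \<open>Distribution of the files\<close>

lemma card_samples: "card samples = card files * card keys"
  by (simp add: samples_def card_cartesian_product card_image inj_on_encode)

text \<open>Constraints on single files cut out a product set, so the count factors. General
  \<open>J\<close> gives independence, singletons give the laws of files and packets.\<close>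

lemma prob_files:
  assumes "J \<subseteq> {1..K}"
  shows "prob {\<omega> \<in> samples. \<forall>k\<in>J. sample_file k \<omega> \<in> B k} =
    (\<Prod>k\<in>J. card (B k \<inter> vectors file_length) / CARD('a) ^ file_length)"
proof -
  let ?V = "vectors file_length :: 'a list set"
  let ?E = "\<lambda>k. if k \<in> J then B k \<inter> ?V else ?V"
  have "w \<in> PiE {1..K} ?E \<longleftrightarrow> w \<in> files \<and> (\<forall>k\<in>J. w k \<in> B k)" for w
    unfolding files_def PiE_iff using assms by (auto split: if_split_asm)
  then have "{\<omega> \<in> samples. \<forall>k\<in>J. sample_file k \<omega> \<in> B k} = PiE {1..K} ?E \<times> encode ` keys"
    unfolding samples_def sample_file_def by (simp add: set_eq_iff) blast
  then have "card {\<omega> \<in> samples. \<forall>k\<in>J. sample_file k \<omega> \<in> B k} = (\<Prod>k=1..K. card (?E k)) * card keys"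
    by (simp add: card_cartesian_product card_image inj_on_encode card_PiE)
  moreover have "card keys \<noteq> 0"
    using finite_keys keys_nonempty by simp
  ultimately have "prob {\<omega> \<in> samples. \<forall>k\<in>J. sample_file k \<omega> \<in> B k} = (\<Prod>k=1..K. card (?E k)) / CARD('a) ^ (K * file_length)"
    by (subst prob_eq) (auto simp: card_samples card_files)
  also have "\<dots> = (\<Prod>k=1..K. card (?E k) / CARD('a) ^ file_length)"
    by (simp add: prod_dividef power_mult [symmetric] mult.commute)
  \<comment> \<open>A file outside \<open>J\<close> is unconstrained and contributes the factor
    1.\<close>
  also have "\<dots> = (\<Prod>k\<in>J. card (B k \<inter> ?V) / CARD('a) ^ file_length)"
    using assms by (intro prod.mono_neutral_cong_right) (auto simp: card_vectors)
  finally show ?thesis .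
qed

lemma file_in_vectors: "\<omega> \<in> samples \<Longrightarrow> k \<in> {1..K} \<Longrightarrow> sample_file k \<omega> \<in> vectors file_length"
  by (auto simp: samples_def files_def sample_file_def)

lemma indep_files: "indep_vars (\<lambda>_. count_space (vectors file_length)) sample_file {1..K}"
  unfolding indep_vars_def2 indep_sets_def
proof (intro conjI ballI allI impI)
  fix J and E :: "nat \<Rightarrow> ((nat \<Rightarrow> 'a list) \<times> nat) set"
  assume J: "J \<subseteq> {1..K}" "J \<noteq> {}" "finite J"
    and "E \<in> (\<Pi> k\<in>J. {sample_file k -` B \<inter> space (uniform_count_measure samples) |B.
      B \<in> sets (count_space (vectors file_length))})"
  then have "\<forall>k\<in>J. \<exists>B. E k = sample_file k -` B \<inter> samples"
    unfolding Pi_iff space_uniform by blast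
  then obtain B where B: "\<And>k. k \<in> J \<Longrightarrow> E k = sample_file k -` B k \<inter> samples"
    by metis
  have "(\<Inter>k\<in>J. E k) = {\<omega> \<in> samples. \<forall>k\<in>J. sample_file k \<omega> \<in> B k}"
    using J B by auto
  then have "prob (\<Inter>k\<in>J. E k) = (\<Prod>k\<in>J. card (B k \<inter> vectors file_length) / CARD('a) ^ file_length)"
    using prob_files [OF J(1)] by simp
  also have "\<dots> = (\<Prod>k\<in>J. prob (E k))"
  proof (intro prod.cong refl)
    fix k assume k: "k \<in> J"
    have "E k = {\<omega> \<in> samples. \<forall>k\<in>{k}. sample_file k \<omega> \<in> B k}"
      using B [OF k] by auto
    then show "card (B k \<inter> vectors file_length) / CARD('a) ^ file_length = prob (E k)"
      using prob_files [of "{k}" B] J k by auto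
  qed
  finally show "prob (\<Inter>k\<in>J. E k) = (\<Prod>k\<in>J. prob (E k))" .
qed (use file_in_vectors in \<open>auto simp: sets_uniform_count_measure\<close>)

lemma distr_file:
  assumes "k \<in> {1..K}"
  shows "distr (uniform_count_measure samples) (count_space (vectors file_length)) (sample_file k) =
    uniform_count_measure (vectors file_length)"
proof (rule measure_eqI_finite [where A = "vectors file_length"])
  fix x :: "'a list" assume x: "x \<in> vectors file_length"
  have "sample_file k -` {x} \<inter> samples = {\<omega> \<in> samples. \<forall>k\<in>{k}. sample_file k \<omega> \<in> {x}}"
    by auto
  then have "prob (sample_file k -` {x} \<inter> samples) = 1 / CARD('a) ^ file_length"
    using prob_files [of "{k}" "\<lambda>_. {x}"] assms x by simp
  then show "emeasure (distr (uniform_count_measure samples) (count_space (vectors file_length)) (sample_file k)) {x} =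
      emeasure (uniform_count_measure (vectors file_length)) {x}"
    using assms x file_in_vectors
    by (subst emeasure_distr)
      (auto simp: emeasure_eq_measure emeasure_uniform_count_measure finite_vectors card_vectors)
qed (simp_all add: finite_vectors sets_uniform_count_measure)

lemma coords_nonempty: "f \<in> {1..s * (M - 1)} \<Longrightarrow> coords k f \<noteq> {}"
  using a_pos piece_less packet_end_step [of f] by (simp add: coords_def)

sublocale sc_pir_storage "uniform_count_measure samples" "real M / real N" N K file_length
  "s * (M - 1)" sample_file coords storage
proof unfold_locales
  show "1 \<le> file_length" by (rule file_length_pos)
qed (rule indep_files distr_file coords_nonempty disjoint_coords UN_coords; assumption?)+

section \<open>Answers as linear combinations of packets\<close>

lemma storage_subset: "storage n \<subseteq> {1..s * (M - 1)}"
  by (auto simp: storage_def)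

lemma finite_storage [simp]: "finite (storage n)"
  using storage_subset by (rule finite_subset) simp

lemma index_in_storage_iff:
  assumes "i < s" "c \<noteq> 0" "c < M"
  shows "index i c \<in> storage n \<longleftrightarrow> n \<in> S i"
  using index_in [OF assms] piece_index [OF assms(2,3)] by (simp add: storage_def)

lemma piece_Suc: "piece (Suc g) = g div (M - 1)"
  by (simp add: piece_def)

lemma card_coords: "f \<in> {1..s * (M - 1)} \<Longrightarrow> card (coords k f) = a (piece f)"
  using packet_end_step [of f] by (simp add: coords_def)

lemma max_packet_length_ge:
  assumes "i < s" "n \<in> S i"
  shows "a i \<le> max_packet_length n"
proof -
  \<comment> \<open>Packet 1 of the piece exists because \<open>2 \<le> M\<close>; file 1, used
    below, exists because \<open>1 \<le> K\<close>.\<close>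
  have f: "index i 1 \<in> storage n" "piece (index i 1) = i"
    using index_in_storage_iff [of i 1] piece_index [of 1 i] assms M_ge_2 by simp_all
  then have "a i = card (coords 1 (index i 1))"
    using card_coords storage_subset by (metis subsetD)
  then show ?thesis
    unfolding max_packet_length_def using f K_pos by (force intro!: Max_ge)
qed

lemma length_packet:
  assumes "\<omega> \<in> samples" "k \<in> {1..K}" "f \<in> {1..s * (M - 1)}"
  shows "length (packet k f \<omega>) = a (piece f)"
  and nth_default_packet: "nth_default 0 (packet k f \<omega>) t =
    (if t < a (piece f) then sample_file k \<omega> ! (packet_end (f - 1) + t) else 0)"
proof -
  have p: "packet k f \<omega> = take (a (piece f)) (drop (packet_end (f - 1)) (sample_file k \<omega>))"
    using packet_end_step [of f] assms(3) by (simp add: packet_def coords_def nths_atLeastLessThan)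
  have "packet_end (f - 1) + a (piece f) \<le> length (sample_file k \<omega>)"
    using packet_end_step [of f] packet_end_le [of f] file_in_vectors [OF assms(1,2)] assms(3)
    by (simp add: vectors_def)
  then show len: "length (packet k f \<omega>) = a (piece f)"
    and "nth_default 0 (packet k f \<omega>) t =
      (if t < a (piece f) then sample_file k \<omega> ! (packet_end (f - 1) + t) else 0)"
    by (simp_all add: p nth_default_def)
qed

lemma decode_less:
  assumes "i < s" "k \<in> {1..K}"
  shows "decode q (i, k) < M"
proof -
  have "(i, k) \<in> {..<s} \<times> {1..K}"
    using assms by simp
  then show ?thesis
    using PiE_mem [OF decode_in_keys [unfolded keys_def]] by blast
qed

text \<open>Of every file at most one stored packet has a nonzero coefficient, the one that the
  query selects, and its padding agrees with the convention in \<open>symb\<close>.\<close>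

lemma linear_combination_coeff:
  assumes "\<omega> \<in> samples" "i < s"
  shows "linear_combination n (coeff n q (Suc i)) \<omega> =
    map (\<lambda>t. if n \<in> S i then \<Sum>k = 1..K. symb i (decode q (i, k)) t (fst \<omega> k) else 0)
      [0..<max_packet_length n]"
proof -
  have "(\<Sum>f\<in>storage n. coeff n q (Suc i) k f * nth_default 0 (packet k f \<omega>) t) =
      (if n \<in> S i then symb i (decode q (i, k)) t (fst \<omega> k) else 0)" if k: "k \<in> {1..K}" for k t
  proof (cases "decode q (i, k) = 0")
    case False
    let ?f = "index i (decode q (i, k))"
    note c = decode_less [OF assms(2) k, of q]
    have "(\<Sum>f\<in>storage n. coeff n q (Suc i) k f * nth_default 0 (packet k f \<omega>) t) =
        (\<Sum>f\<in>storage n. if f = ?f then nth_default 0 (packet k ?f \<omega>) t else 0)"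
      using False by (intro sum.cong) (auto simp: coeff_def)
    also have "\<dots> = (if n \<in> S i then nth_default 0 (packet k ?f \<omega>) t else 0)"
      using index_in_storage_iff [OF assms(2) False c] by simp
    finally show ?thesis
      unfolding nth_default_packet [OF assms(1) k index_in [OF assms(2) False c]]
        piece_index [OF False c]
      using False by (simp add: symb_def sample_file_def)
  qed (simp add: coeff_def symb_def)
  then show ?thesis
    unfolding linear_combination_def by (intro map_cong refl) simp
qed

text \<open>Describes an answer by the decoded query and the files alone, so that it can be studied
  without the sample space.\<close>

definition response :: "nat \<Rightarrow> (nat \<times> nat \<Rightarrow> nat) \<Rightarrow> (nat \<Rightarrow> 'a list) \<Rightarrow> 'a list list" where
  "response n q w = map (\<lambda>i. map (\<lambda>t. if n \<in> S i then \<Sum>k = 1..K. symb i (q (i, k)) t (w k) else 0)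
    [0..<max_packet_length n]) [0..<s]"

lemma answer_eq_response:
  assumes "\<omega> \<in> samples"
  shows "answer \<theta> n \<omega> = response n (decode (query \<theta> n \<omega>)) (fst \<omega>)"
proof -
  have "answer \<theta> n \<omega> = map (\<lambda>i. linear_combination n (coeff n (query \<theta> n \<omega>) (Suc i)) \<omega>) [0..<s]"
    unfolding answer_def One_nat_def map_Suc_upt [symmetric] by simp
  then show ?thesis
    unfolding response_def using linear_combination_coeff [OF assms] by simp
qed

text \<open>Beyond \<open>a i\<close> all symbols of piece \<open>i\<close> are 0, and a server
  returns 0 for pieces that it does not store; neither distinguishes responses.\<close>

lemma response_eq_iff:
  "response n q w = response n q w' \<longleftrightarrow> (\<forall>i<s. n \<in> S i \<longrightarrow> (\<forall>t<a i.
    (\<Sum>k = 1..K. symb i (q (i, k)) t (w k)) = (\<Sum>k = 1..K. symb i (q (i, k)) t (w' k))))"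
    (is "_ \<longleftrightarrow> ?R")
proof -
  have "response n q w = response n q w' \<longleftrightarrow> (\<forall>i<s. n \<in> S i \<longrightarrow> (\<forall>t<max_packet_length n.
    (\<Sum>k = 1..K. symb i (q (i, k)) t (w k)) = (\<Sum>k = 1..K. symb i (q (i, k)) t (w' k))))"
    by (auto simp: response_def)
  also have "\<dots> \<longleftrightarrow> ?R"
  proof (intro iffI allI impI)
    fix i t assume "\<forall>i<s. n \<in> S i \<longrightarrow> (\<forall>t<max_packet_length n.
      (\<Sum>k = 1..K. symb i (q (i, k)) t (w k)) = (\<Sum>k = 1..K. symb i (q (i, k)) t (w' k)))"
      and "i < s" "n \<in> S i" "t < a i"
    then show "(\<Sum>k = 1..K. symb i (q (i, k)) t (w k)) = (\<Sum>k = 1..K. symb i (q (i, k)) t (w' k))"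
      using max_packet_length_ge [of i n] by simp
  next
    fix i t assume "?R" "i < s" "n \<in> S i"
    then show "(\<Sum>k = 1..K. symb i (q (i, k)) t (w k)) = (\<Sum>k = 1..K. symb i (q (i, k)) t (w' k))"
      by (cases "t < a i") (simp_all add: symb_def)
  qed
  finally show ?thesis .
qed

section \<open>Entropy of the answers\<close>

definition response_size :: "nat \<Rightarrow> (nat \<times> nat \<Rightarrow> nat) \<Rightarrow> nat" where
  "response_size n q = (\<Sum>i<s. if n \<in> S i \<and> (\<exists>k\<in>{1..K}. q (i, k) \<noteq> 0) then a i else 0)"

text \<open>A response amounts to one linear equation for every coordinate of every stored piece
  whose query is nonzero, hence to \<open>response_size n q\<close> equations. Each has a pivot in a
  file with nonzero query entry, and no other equation involves this pivot as pieces do not overlap.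
  So all fibres have the same size.\<close>

lemma card_response_fibre:
  assumes q: "q \<in> keys"
  shows "card {w \<in> files. response n q w = response n q w0} * CARD('a) ^ response_size n q = card files"
proof -
  define act where "act = {i \<in> {..<s}. n \<in> S i \<and> (\<exists>k\<in>{1..K}. q (i, k) \<noteq> 0)}"
  define piv where "piv i = (SOME k. k \<in> {1..K} \<and> q (i, k) \<noteq> 0)" for i
  \<comment> \<open>\<open>D\<close> indexes the equations, \<open>c\<close> gives their pivots,
    \<open>h\<close> collects the remaining terms, and \<open>\<phi>\<close> assembles coordinates
    into files.\<close>
  define D where "D = (SIGMA i:act. {..<a i})"
  define coord where "coord i k t = (k, packet_end (index i (q (i, k)) - 1) + t)" for i k t
  define c where "c = (\<lambda>(i, t). coord i (piv i) t)"
  define h where "h = (\<lambda>(i, t) v. \<Sum>k\<in>{1..K} - {piv i}. if q (i, k) \<noteq> 0 then v (coord i k t) else (0 :: 'a))"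
  define \<phi> where "\<phi> v = (\<lambda>k\<in>{1..K}. map (\<lambda>t. v (k, t)) [0..<file_length])" for v :: "nat \<times> nat \<Rightarrow> 'a"
  let ?C = "{1..K} \<times> {..<file_length}"
  let ?x = "\<lambda>(i, t). \<Sum>k = 1..K. symb i (q (i, k)) t (w0 k)"
  have piv: "piv i \<in> {1..K}" "q (i, piv i) \<noteq> 0" "i < s" if "i \<in> act" for i
  proof -
    have "\<exists>k. k \<in> {1..K} \<and> q (i, k) \<noteq> 0"
      using that unfolding act_def by blast
    then have "piv i \<in> {1..K} \<and> q (i, piv i) \<noteq> 0"
      unfolding piv_def by (rule someI_ex)
    then show "piv i \<in> {1..K}" "q (i, piv i) \<noteq> 0" "i < s"
      using that by (simp_all add: act_def)
  qed
  have q_less: "q (i, k) < M" if "i < s" "k \<in> {1..K}" for i k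
    using PiE_mem [OF q [unfolded keys_def], of "(i, k)"] that by simp
  have coord_in: "coord i k t \<in> ?C" if "i < s" "k \<in> {1..K}" "q (i, k) \<noteq> 0" "t < a i" for i k t
    using symbol_coordinate(2) [OF that(1,3) q_less that(4)] that by (simp add: coord_def)
  have coord_inj: "i = i' \<and> k = k' \<and> t = t'"
    if "i < s" "k \<in> {1..K}" "q (i, k) \<noteq> 0" "t < a i"
      "i' < s" "k' \<in> {1..K}" "q (i', k') \<noteq> 0" "t' < a i'" "coord i k t = coord i' k' t'" for i k t i' k' t'
  proof -
    have eq: "packet_end (index i (q (i, k)) - 1) + t = packet_end (index i' (q (i', k')) - 1) + t'"
      and "k = k'"
      using that(9) unfolding coord_def by blast+
    moreover have "i = i'" "t = t'"
      by (rule symbol_coordinate_inj [OF that(1,3) q_less [OF that(1,2)] that(4,5,7)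
            q_less [OF that(5,6)] that(8) eq])+
    ultimately show ?thesis
      by blast
  qed
  have symb: "symb i (q (i, k)) t (\<phi> v k) = (if q (i, k) \<noteq> 0 then v (coord i k t) else 0)"
    if "i < s" "k \<in> {1..K}" "t < a i" for i k t v
    using that coord_in [OF that(1,2) _ that(3)] by (auto simp: symb_def \<phi>_def coord_def)
  have inj: "inj_on c D"
  proof (rule inj_onI)
    fix d d' assume "d \<in> D" "d' \<in> D" "c d = c d'"
    then obtain i t i' t' where "d = (i, t)" "i \<in> act" "t < a i" "d' = (i', t')" "i' \<in> act" "t' < a i'"
      "coord i (piv i) t = coord i' (piv i') t'"
      by (auto simp: D_def c_def)
    then show "d = d'"
      using coord_inj [of i "piv i" t i' "piv i'" t'] piv [of i] piv [of i'] by blast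
  qed
  have sub: "c ` D \<subseteq> ?C"
  proof (rule image_subsetI)
    fix d assume "d \<in> D"
    then obtain i t where "i \<in> act" "t < a i" "c d = coord i (piv i) t"
      by (auto simp: D_def c_def)
    then show "c d \<in> ?C"
      using coord_in [of i "piv i" t] piv [of i] by simp
  qed
  have h_cong: "h d v = h d v'" if d: "d \<in> D" and eq: "\<And>e. e \<in> ?C - c ` D \<Longrightarrow> v e = v' e" for d v v'
  proof -
    obtain i t where it: "d = (i, t)" "i \<in> act" "t < a i"
      using d by (auto simp: D_def)
    have v: "v (coord i k t) = v' (coord i k t)" if k: "k \<in> {1..K} - {piv i}" "q (i, k) \<noteq> 0" for k
    proof -
      \<comment> \<open>By injectivity, a pivot that occurs in \<open>h\<close> would belong to the
        same equation and to the file \<open>piv i\<close>, which \<open>h\<close> omits.\<close>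
      have "coord i k t \<notin> c ` D"
      proof
        assume "coord i k t \<in> c ` D"
        then obtain i' t' where "i' \<in> act" "t' < a i'" "coord i k t = coord i' (piv i') t'"
          by (auto simp: D_def c_def)
        then have "i = i' \<and> k = piv i' \<and> t = t'"
          using coord_inj [of i k t i' "piv i'" t'] piv [of i] piv [of i'] it k by blast
        then show False
          using k by simp
      qed
      then show ?thesis
        using coord_in [of i k t] piv [of i] it k by (intro eq) auto
    qed
    then show ?thesis
      unfolding h_def it prod.case by (intro sum.cong refl if_cong v)
  qed
  have *: "card {v \<in> ?C \<rightarrow>\<^sub>E UNIV. \<forall>d\<in>D. v (c d) + h d v = ?x d} * CARD('a) ^ card D =
      CARD('a) ^ card ?C"
  proof (rule card_PiE_pivots [OF _ inj sub])
    fix d and v v' :: "nat \<times> nat \<Rightarrow> 'a"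
    assume "d \<in> D" "\<And>e. e \<in> ?C - c ` D \<Longrightarrow> v e = v' e"
    then show "h d v = h d v'"
      by (rule h_cong)
  qed simp
  have "response n q (\<phi> v) = response n q w0 \<longleftrightarrow> (\<forall>d\<in>D. v (c d) + h d v = ?x d)" for v
  proof -
    have act_sum: "(\<Sum>k = 1..K. symb i (q (i, k)) t (\<phi> v k)) = v (c (i, t)) + h (i, t) v"
      if "i \<in> act" "t < a i" for i t
    proof -
      have "(\<Sum>k = 1..K. symb i (q (i, k)) t (\<phi> v k)) =
          (\<Sum>k = 1..K. if q (i, k) \<noteq> 0 then v (coord i k t) else 0)"
        using symb piv that by (intro sum.cong) auto
      also have "\<dots> = v (coord i (piv i) t) + h (i, t) v"
        using piv that by (subst sum.remove [of _ "piv i"]) (auto simp: h_def)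
      finally show ?thesis
        by (simp add: c_def)
    qed
    \<comment> \<open>For a stored piece with zero query only dummy symbols are added, so it imposes
      no equation.\<close>
    have inact_sum: "(\<Sum>k = 1..K. symb i (q (i, k)) t (w k)) = 0"
      if "i < s" "n \<in> S i" "i \<notin> act" for i t w
      using that by (intro sum.neutral) (auto simp: act_def symb_def)
    show ?thesis
    proof
      assume L: "response n q (\<phi> v) = response n q w0"
      show "\<forall>d\<in>D. v (c d) + h d v = ?x d"
      proof
        fix d assume "d \<in> D"
        then obtain i t where it: "d = (i, t)" "i \<in> act" "t < a i"
          by (auto simp: D_def)
        then have "i < s" "n \<in> S i"
          by (simp_all add: act_def)
        then have "(\<Sum>k = 1..K. symb i (q (i, k)) t (\<phi> v k)) = (\<Sum>k = 1..K. symb i (q (i, k)) t (w0 k))"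
          using L it(3) unfolding response_eq_iff by blast
        then show "v (c d) + h d v = ?x d"
          unfolding it(1) using act_sum [OF it(2,3)] by simp
      qed
    next
      assume R: "\<forall>d\<in>D. v (c d) + h d v = ?x d"
      show "response n q (\<phi> v) = response n q w0"
        unfolding response_eq_iff
      proof (intro allI impI)
        fix i t assume it: "i < s" "n \<in> S i" "t < a i"
        show "(\<Sum>k = 1..K. symb i (q (i, k)) t (\<phi> v k)) = (\<Sum>k = 1..K. symb i (q (i, k)) t (w0 k))"
        proof (cases "i \<in> act")
          case True
          then have "(i, t) \<in> D"
            using it by (simp add: D_def)
          then show ?thesis
            using R act_sum [OF True it(3)] by fastforce
        next
          case False
          then show ?thesis
            by (simp only: inact_sum [OF it(1,2) False])
        qed
      qed
    qed
  qed
  moreover have "bij_betw \<phi> (?C \<rightarrow>\<^sub>E UNIV) files"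
    unfolding files_def \<phi>_def by (rule bij_betw_vectors)
  ultimately have "card {w \<in> files. response n q w = response n q w0} =
      card {v \<in> ?C \<rightarrow>\<^sub>E UNIV. \<forall>d\<in>D. v (c d) + h d v = ?x d}"
    by (simp only: card_Collect_bij_betw)
  moreover have "card D = response_size n q"
    unfolding D_def response_size_def act_def
    by (subst card_SigmaI) (simp_all add: sum.inter_filter [symmetric])
  ultimately show ?thesis
    using * by (simp add: card_files card_cartesian_product)
qed

text \<open>After exchanging the sums, each piece at the server counts with its weight for the keys
  that do not vanish on it. These are a proportion \<open>1 - 1 / M ^ K\<close> of all keys, and the
  weights add up to \<open>M\<close>.\<close>

lemma sum_response_size:
  assumes "n \<in> {1..N}"
  shows "real (\<Sum>q\<in>keys. response_size n q) = real (card keys) * (M * (1 - 1 / M ^ K))"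
proof -
  have M_pos: "0 < real M"
    using M_ge_2 by simp
  have act: "real (card {q \<in> keys. \<exists>k\<in>{1..K}. q (i, k) \<noteq> 0}) = card keys * (1 - 1 / M ^ K)"
    if i: "i < s" for i
  proof -
    let ?Z = "{q \<in> keys. \<forall>k\<in>{1..K}. q (i, k) = 0}"
    let ?B = "\<lambda>(j, k :: nat). if j = i then {0} else {..<M}"
    have "q \<in> ?Z \<longleftrightarrow> q \<in> PiE ({..<s} \<times> {1..K}) ?B" for q
      unfolding keys_def PiE_iff using i M_ge_2 by (auto split: if_split_asm)
    then have "?Z = PiE ({..<s} \<times> {1..K}) ?B"
      by blast
    then have "card ?Z = (\<Prod>z\<in>{..<s} \<times> {1..K}. card (?B z))"
      by (simp only: card_PiE finite_cartesian_product finite_lessThan finite_atLeastAtMost)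
    also have "\<dots> = (\<Prod>j<s. \<Prod>k=1..K. card (?B (j, k)))"
      by (simp only: prod.cartesian_product) (simp add: case_prod_unfold)
    also have "\<dots> = (\<Prod>j<s. if j = i then 1 else M ^ K)"
      by (intro prod.cong) auto
    \<comment> \<open>The factor missing at piece \<open>i\<close> is restored, so the keys that
      vanish there are a proportion \<open>1 / M ^ K\<close> of all.\<close>
    also have "\<dots> * M ^ K = (\<Prod>j<s. M ^ K)"
    proof -
      have "(\<Prod>j<s. if j = i then 1 else M ^ K) = (\<Prod>j\<in>{..<s} - {i}. M ^ K)"
        using i by (subst prod.remove [of _ i]) simp_all
      moreover have "(\<Prod>j<s. M ^ K) = M ^ K * (\<Prod>j\<in>{..<s} - {i}. M ^ K)"
        by (rule prod.remove) (use i in simp_all)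
      ultimately show ?thesis
        by (simp only: mult.commute)
    qed
    also have "\<dots> = card keys"
      by (simp add: keys_def card_PiE power_mult mult.commute)
    finally have Z: "card ?Z * M ^ K = card keys" .
    have "{q \<in> keys. \<exists>k\<in>{1..K}. q (i, k) \<noteq> 0} = keys - ?Z"
      by auto
    then have "card {q \<in> keys. \<exists>k\<in>{1..K}. q (i, k) \<noteq> 0} = card keys - card ?Z"
      using finite_keys by (simp add: card_Diff_subset)
    moreover have "card ?Z \<le> card keys"
      using finite_keys by (intro card_mono) auto
    ultimately have "real (card {q \<in> keys. \<exists>k\<in>{1..K}. q (i, k) \<noteq> 0}) = real (card keys) - card ?Z"
      by simp
    also have "real (card ?Z) = card keys / M ^ K"
      using Z [symmetric] M_pos by simp
    finally show ?thesis
      by (simp add: algebra_simps)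
  qed
  have "(\<Sum>q\<in>keys. response_size n q) =
      (\<Sum>i<s. \<Sum>q\<in>keys. if n \<in> S i \<and> (\<exists>k\<in>{1..K}. q (i, k) \<noteq> 0) then a i else 0)"
    unfolding response_size_def by (rule sum.swap)
  also have "\<dots> = (\<Sum>i<s. (if n \<in> S i then a i else 0) * card {q \<in> keys. \<exists>k\<in>{1..K}. q (i, k) \<noteq> 0})"
    using finite_keys by (intro sum.cong refl) (simp add: sum.inter_filter [symmetric])
  finally have "real (\<Sum>q\<in>keys. response_size n q) =
      (\<Sum>i<s. real (if n \<in> S i then a i else 0) * (card keys * (1 - 1 / M ^ K)))"
    using act by simp
  also have "\<dots> = real (\<Sum>i<s. if n \<in> S i then a i else 0) * (card keys * (1 - 1 / M ^ K))"
    unfolding sum_distrib_right [symmetric] of_nat_sum ..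
  finally show ?thesis
    unfolding load [OF assms] by (simp add: algebra_simps)
qed

text \<open>Given the query, the answer is uniform on its possible values, with entropy
  \<open>response_size\<close>. The mean of this over uniform queries is known.\<close>

lemma answer_entropy:
  assumes "n \<in> {1..N}"
  shows "\<H>(answer \<theta> n | query \<theta> n) = M * (1 - 1 / M ^ K)"
proof -
  have "\<H>(answer \<theta> n | query \<theta> n) =
      (\<Sum>\<omega>\<in>samples. real (response_size n (decode (query \<theta> n \<omega>)))) / card samples"
  proof (rule conditional_entropy_uniform_fibres)
    fix \<omega> assume \<omega>: "\<omega> \<in> samples"
    define q where "q = decode (query \<theta> n \<omega>)"
    have q: "q \<in> keys"
      by (simp add: q_def decode_in_keys)
    have query_iff: "query \<theta> n \<omega>' = query \<theta> n \<omega> \<longleftrightarrow> snd \<omega>' = snd \<omega>" if "\<omega>' \<in> samples" for \<omega>'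
      using that \<omega> by (rule query_eq_iff)
    have "answer \<theta> n \<omega>' = answer \<theta> n \<omega> \<and> query \<theta> n \<omega>' = query \<theta> n \<omega> \<longleftrightarrow>
        response n q (fst \<omega>') = response n q (fst \<omega>) \<and> snd \<omega>' = snd \<omega>" if "\<omega>' \<in> samples" for \<omega>'
      using query_iff [OF that] answer_eq_response [OF that] answer_eq_response [OF \<omega>] q_def by metis
    then have "{\<omega>' \<in> samples. answer \<theta> n \<omega>' = answer \<theta> n \<omega> \<and> query \<theta> n \<omega>' = query \<theta> n \<omega>} =
        {\<omega>' \<in> samples. response n q (fst \<omega>') = response n q (fst \<omega>) \<and> snd \<omega>' = snd \<omega>}"
      by blast
    \<comment> \<open>Files and key are chosen independently, so the count factors. The factor for
      the key appears on both sides of the fibre condition.\<close>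
    then have 1: "card {\<omega>' \<in> samples. answer \<theta> n \<omega>' = answer \<theta> n \<omega> \<and> query \<theta> n \<omega>' = query \<theta> n \<omega>} =
        card {w \<in> files. response n q w = response n q (fst \<omega>)} * card {r \<in> encode ` keys. r = snd \<omega>}"
      using card_Times_Collect [of files "encode ` keys" "\<lambda>w. response n q w = response n q (fst \<omega>)"
          "\<lambda>r. r = snd \<omega>"] unfolding samples_def by simp
    have "{\<omega>' \<in> samples. query \<theta> n \<omega>' = query \<theta> n \<omega>} = {\<omega>' \<in> samples. True \<and> snd \<omega>' = snd \<omega>}"
      using query_iff by blast
    then have 2: "card {\<omega>' \<in> samples. query \<theta> n \<omega>' = query \<theta> n \<omega>} =
        card files * card {r \<in> encode ` keys. r = snd \<omega>}"
      using card_Times_Collect [of files "encode ` keys" "\<lambda>_. True" "\<lambda>r. r = snd \<omega>"]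
      unfolding samples_def by simp
    have "card {w \<in> files. response n q w = response n q (fst \<omega>)} * card {r \<in> encode ` keys. r = snd \<omega>} *
        CARD('a) ^ response_size n q = card files * card {r \<in> encode ` keys. r = snd \<omega>}"
      unfolding card_response_fibre [OF q, of n "fst \<omega>", symmetric] by (simp only: mult_ac)
    then show "real (card {\<omega>' \<in> samples. answer \<theta> n \<omega>' = answer \<theta> n \<omega> \<and> query \<theta> n \<omega>' = query \<theta> n \<omega>}) *
        real CARD('a) ^ response_size n (decode (query \<theta> n \<omega>)) =
        real (card {\<omega>' \<in> samples. query \<theta> n \<omega>' = query \<theta> n \<omega>})"
      unfolding 1 2 q_def [symmetric] of_nat_power [symmetric] of_nat_mult [symmetric] of_nat_eq_iff .
  qed
  also have "(\<Sum>\<omega>\<in>samples. real (response_size n (decode (query \<theta> n \<omega>)))) =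
      (\<Sum>w\<in>files. \<Sum>r\<in>encode ` keys. real (response_size n (shift \<theta> n (decode r))))"
    unfolding samples_def sum.cartesian_product decode_query by (simp add: case_prod_unfold)
  also have "\<dots> = card files * (\<Sum>f\<in>keys. real (response_size n (shift \<theta> n f)))"
    by (simp add: sum.reindex inj_on_encode decode_encode)
  \<comment> \<open>Reindexing by the shift expresses that the query is uniform.\<close>
  also have "(\<Sum>f\<in>keys. real (response_size n (shift \<theta> n f))) = (\<Sum>q\<in>keys. real (response_size n q))"
    by (rule sum.reindex_bij_betw [OF bij_betw_shift])
  also have "\<dots> = card keys * (M * (1 - 1 / M ^ K))"
    using sum_response_size [OF assms] by simp
  finally show ?thesis
    using finite_files files_nonempty finite_keys keys_nonempty by (simp add: card_samples)
qed

section \<open>Decodability, privacy and storage\<close>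

text \<open>Over the servers that store piece \<open>i\<close>, the query entry of the desired file
  runs through all residues, while the other entries stay fixed. So two answers differ by two
  symbols of the desired file, one of which can be taken as the dummy.\<close>

lemma answers_recover_file:
  assumes \<omega>: "\<omega> \<in> samples" "\<omega>' \<in> samples" and \<theta>: "\<theta> \<in> {1..K}"
    and A: "\<And>n. n \<in> {1..N} \<Longrightarrow> answer \<theta> n \<omega> = answer \<theta> n \<omega>'"
    and Q: "\<And>n. n \<in> {1..N} \<Longrightarrow> query \<theta> n \<omega> = query \<theta> n \<omega>'"
  shows "sample_file \<theta> \<omega> = sample_file \<theta> \<omega>'"
proof (rule vectors_eqI)
  show "sample_file \<theta> \<omega> \<in> vectors file_length" "sample_file \<theta> \<omega>' \<in> vectors file_length"
    using \<omega> \<theta> by (simp_all add: file_in_vectors)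
  fix i c t assume ict: "i < s" "c \<noteq> 0" "c < M" "t < a i"
  define f where "f = decode (snd \<omega>)"
  \<comment> \<open>\<open>R\<close> is the interference of the other files, the same at every
    server. The shift reduces their entries modulo \<open>M\<close> as well.\<close>
  define R where "R w = (\<Sum>k\<in>{1..K} - {\<theta>}. symb i (f (i, k) mod M) t (w k))" for w
  have eq: "R (fst \<omega>) + symb i d t (fst \<omega> \<theta>) = R (fst \<omega>') + symb i d t (fst \<omega>' \<theta>)"
    if d: "d < M" for d
  proof -
    \<comment> \<open>This is the position of the server that is asked for symbol \<open>d\<close>;
      adding \<open>M\<close> avoids truncated subtraction.\<close>
    have "(d + M - f (i, \<theta>)) mod M \<in> pos i ` S i"
      using bij_betw_imp_surj_on [OF pos [OF ict(1)]] M_ge_2 by simp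
    then obtain n where n: "n \<in> S i" "pos i n = (d + M - f (i, \<theta>)) mod M"
      by auto
    then have n_N: "n \<in> {1..N}"
      using S_subset [OF ict(1)] by blast
    have "f (i, \<theta>) < M"
      using decode_less [OF ict(1) \<theta>] by (simp add: f_def)
    then have "(f (i, \<theta>) + pos i n) mod M = d"
      using d unfolding n(2) mod_add_right_eq by simp
    then have split: "(\<Sum>k = 1..K. symb i (shift \<theta> n f (i, k)) t (w k)) = R w + symb i d t (w \<theta>)" for w
      using \<theta> ict(1) by (subst sum.remove [of _ \<theta>]) (auto simp: R_def shift_def intro!: sum.cong)
    have "response n (shift \<theta> n f) (fst \<omega>) = response n (shift \<theta> n f) (fst \<omega>')"
      using A [OF n_N] Q [OF n_N] \<omega> by (metis answer_eq_response decode_query f_def)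
    then have "(\<Sum>k = 1..K. symb i (shift \<theta> n f (i, k)) t (fst \<omega> k)) =
        (\<Sum>k = 1..K. symb i (shift \<theta> n f (i, k)) t (fst \<omega>' k))"
      unfolding response_eq_iff using ict n(1) by blast
    then show ?thesis
      unfolding split .
  qed
  \<comment> \<open>The dummy symbol \<open>d = 0\<close> gives equal interference, which then
    cancels in the equation for \<open>c\<close>.\<close>
  show "symb i c t (sample_file \<theta> \<omega>) = symb i c t (sample_file \<theta> \<omega>')"
    using eq [of 0] eq [OF ict(3)] M_ge_2 by (simp add: symb_def sample_file_def)
qed

text \<open>The desired index affects an answer only through the query. This serves both determinacy
  of answers and privacy.\<close>

lemma answer_cong:
  assumes "query \<theta> n \<omega> = query \<theta>' n \<omega>'" "stored n \<omega> = stored n \<omega>'"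
  shows "answer \<theta> n \<omega> = answer \<theta>' n \<omega>'"
proof -
  have "packet k f \<omega> = packet k f \<omega>'" if "k \<in> {1..K}" "f \<in> storage n" for k f
    using fun_cong [OF assms(2), of "(k, f)"] that by (simp add: stored_def)
  then have "linear_combination n b \<omega> = linear_combination n b \<omega>'" for b
    unfolding linear_combination_def by (intro map_cong sum.cong refl) simp
  then show ?thesis
    by (simp add: answer_def assms(1))
qed

text \<open>The permutation keeps the files and replaces the key by the one that produces the same
  query at server \<open>n\<close> when \<open>\<theta>'\<close> is desired.\<close>

lemma queries_private:
  "distr (uniform_count_measure samples) (count_space UNIV) (\<lambda>\<omega>. (query \<theta> n \<omega>, answer \<theta> n \<omega>, stored n \<omega>)) =
   distr (uniform_count_measure samples) (count_space UNIV) (\<lambda>\<omega>. (query \<theta>' n \<omega>, answer \<theta>' n \<omega>, stored n \<omega>))"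
proof (rule distr_uniform_eqI)
  define g where "g r = encode (inv_into keys (shift \<theta>' n) (shift \<theta> n (decode r)))" for r
  have "bij_betw decode (encode ` keys) keys"
    by (rule bij_betw_byWitness [where f' = encode]) (auto simp: decode_encode)
  moreover have "bij_betw encode keys (encode ` keys)"
    using inj_on_encode by (rule inj_on_imp_bij_betw)
  ultimately have "bij_betw (encode \<circ> (inv_into keys (shift \<theta>' n) \<circ> (shift \<theta> n \<circ> decode)))
      (encode ` keys) (encode ` keys)"
    using bij_betw_shift bij_betw_inv_into [OF bij_betw_shift] by (meson bij_betw_trans)
  also have "encode \<circ> (inv_into keys (shift \<theta>' n) \<circ> (shift \<theta> n \<circ> decode)) = g"
    by (simp add: fun_eq_iff g_def)
  finally have g: "bij_betw g (encode ` keys) (encode ` keys)" .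
  show "bij_betw (map_prod id g) samples samples"
    unfolding samples_def using g bij_betw_id [of files]
    by (auto simp: bij_betw_def intro!: map_prod_inj_on map_prod_surj_on)
  fix \<omega> :: "(nat \<Rightarrow> 'a list) \<times> nat"
  have "shift \<theta> n (decode (snd \<omega>)) \<in> shift \<theta>' n ` keys"
    using shift_in_keys [OF decode_in_keys] bij_betw_imp_surj_on [OF bij_betw_shift] by blast
  then have "query \<theta>' n (map_prod id g \<omega>) = query \<theta> n \<omega>"
    by (simp add: query_def g_def decode_encode inv_into_into f_inv_into_f)
  moreover have "stored n (map_prod id g \<omega>) = stored n \<omega>"
    by (simp add: stored_def packet_def sample_file_def)
  moreover from calculation have "answer \<theta>' n (map_prod id g \<omega>) = answer \<theta> n \<omega>"
    by (rule answer_cong)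
  ultimately show "(query \<theta> n \<omega>, answer \<theta> n \<omega>, stored n \<omega>) =
      (query \<theta>' n (map_prod id g \<omega>), answer \<theta>' n (map_prod id g \<omega>), stored n (map_prod id g \<omega>))"
    by simp
qed

text \<open>The files have the same law and are cut alike; below, \<open>coords 0 f\<close> stands
  for the common set of coordinates.\<close>

lemma entropy_packet_eq:
  assumes "k \<in> {1..K}" "k' \<in> {1..K}"
  shows "\<H>(packet k f) = \<H>(packet k' f)"
proof (rule entropy_eqI)
  have prob: "card {\<omega> \<in> samples. packet k f \<omega> = x} =
      card {w \<in> vectors file_length :: 'a list set. nths w (coords 0 f) = x} * card samples / CARD('a) ^ file_length"
    if "k \<in> {1..K}" for k x
  proof -
    have Int_eq: "{w :: 'a list. nths w (coords 0 f) = x} \<inter> vectors file_length =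
        {w \<in> vectors file_length. nths w (coords 0 f) = x}"
      by blast
    have "{\<omega> \<in> samples. \<forall>k\<in>{k}. sample_file k \<omega> \<in> {w. nths w (coords 0 f) = x}} = {\<omega> \<in> samples. packet k f \<omega> = x}"
      by (simp add: packet_def coords_def)
    then have "prob {\<omega> \<in> samples. packet k f \<omega> = x} =
        card {w \<in> vectors file_length :: 'a list set. nths w (coords 0 f) = x} / CARD('a) ^ file_length"
      using prob_files [of "{k}" "\<lambda>_. {w. nths w (coords 0 f) = x}", unfolded Int_eq] that by simp
    then show ?thesis
      using finite_sample nonempty_sample by (subst (asm) prob_eq) (auto simp: field_simps)
  qed
  show card_eq: "card {\<omega> \<in> samples. packet k f \<omega> = x} = card {\<omega> \<in> samples. packet k' f \<omega> = x}" for x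
    using prob [OF assms(1), of x] prob [OF assms(2), of x] by simp
  have mem: "x \<in> packet k f ` samples \<longleftrightarrow> card {\<omega> \<in> samples. packet k f \<omega> = x} \<noteq> 0" for k x
    using finite_sample by auto
  show "packet k f ` samples = packet k' f ` samples"
    by (simp only: set_eq_iff mem card_eq simp_thms)
qed

text \<open>Entropy is at most the number of stored field elements. Per file these are
  \<open>(M - 1) * M\<close>, which is the fraction \<open>M / N\<close> of the file.\<close>

lemma storage_bound:
  assumes "n \<in> {1..N}"
  shows "\<H>(stored n) \<le> real M / real N * K * file_length"
proof -
  let ?B = "\<lambda>(k :: nat, f). vectors (a (piece f)) :: 'a list set"
  let ?E = "PiE ({1..K} \<times> storage n) ?B"
  have sum: "(\<Sum>f\<in>storage n. a (piece f)) = (M - 1) * M"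
  proof -
    have "(\<Sum>f\<in>storage n. a (piece f)) = (\<Sum>f=1..s * (M - 1). if n \<in> S (piece f) then a (piece f) else 0)"
      unfolding storage_def by (rule sum.inter_filter) simp
    also have "\<dots> = (\<Sum>g<s * (M - 1). if n \<in> S (g div (M - 1)) then a (g div (M - 1)) else 0)"
      by (simp only: One_nat_def sum.atLeast1_atMost_eq piece_Suc)
    also have "\<dots> = (M - 1) * (\<Sum>i<s. if n \<in> S i then a i else 0)"
      by (rule sum_div_lessThan)
    finally show ?thesis
      by (simp only: load [OF assms])
  qed
  have "stored n \<omega> \<in> ?E" if "\<omega> \<in> samples" for \<omega>
    unfolding stored_def restrict_PiE_iff
  proof
    fix z assume "z \<in> {1..K} \<times> storage n"
    then obtain k f where "z = (k, f)" "k \<in> {1..K}" "f \<in> storage n"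
      by blast
    then show "(case z of (k, f) \<Rightarrow> packet k f \<omega>) \<in> ?B z"
      using length_packet [OF that, of k f] subsetD [OF storage_subset, of f n]
      by (simp add: vectors_def)
  qed
  then have "\<H>(stored n) \<le> log CARD('a) (card ?E)"
    by (intro entropy_le_log_card finite_PiE) (auto simp: finite_vectors)
  also have "card ?E = CARD('a) ^ (K * ((M - 1) * M))"
  proof -
    have "card ?E = (\<Prod>z\<in>{1..K} \<times> storage n. CARD('a) ^ a (piece (snd z)))"
      by (simp add: card_PiE case_prod_unfold card_vectors)
    also have "\<dots> = CARD('a) ^ (\<Sum>z\<in>{1..K} \<times> storage n. a (piece (snd z)))"
      by (rule power_sum [symmetric])
    also have "(\<Sum>z\<in>{1..K} \<times> storage n. a (piece (snd z))) = (\<Sum>k=1..K. \<Sum>f\<in>storage n. a (piece f))"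
      by (simp only: sum.cartesian_product case_prod_unfold)
    finally show ?thesis
      by (simp add: sum)
  qed
  also have "log CARD('a) (CARD('a) ^ (K * ((M - 1) * M)) :: nat) = real (K * ((M - 1) * M))"
    using base_gt_1 by (simp add: log_nat_power)
  also have "\<dots> = real M / real N * K * file_length"
    using M_ge_2 M_le_N by (simp add: file_length_def)
  finally show ?thesis .
qed

text \<open>The queries are functions of the key, and the sample space is the product of files and
  keys, so joint counts factor.\<close>

lemma queries_files_independent:
  "\<I>((\<lambda>\<omega>. \<lambda>n\<in>{1..N}. query \<theta> n \<omega>) ; all_files) = 0"
proof -
  let ?Q = "\<lambda>\<omega>. \<lambda>n\<in>{1..N}. query \<theta> n \<omega>"
  let ?q = "\<lambda>r. \<lambda>n\<in>{1..N}. encode (shift \<theta> n (decode r))"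
  have all_files: "all_files \<omega> = fst \<omega>" if "\<omega> \<in> samples" for \<omega>
    using that by (auto simp: all_files_def samples_def files_def sample_file_def)
  have Q: "card {\<omega> \<in> samples. ?Q \<omega> = y} = card files * card {r \<in> encode ` keys. ?q r = y}" for y
    using card_Times_Collect [of files "encode ` keys" "\<lambda>_. True" "\<lambda>r. ?q r = y"]
    by (simp add: samples_def query_def)
  have W: "card {\<omega> \<in> samples. all_files \<omega> = x} = card {w \<in> files. w = x} * card keys" for x
  proof -
    have "{\<omega> \<in> samples. all_files \<omega> = x} = {\<omega> \<in> files \<times> encode ` keys. fst \<omega> = x \<and> True}"
      using all_files by (auto simp: samples_def)
    then show ?thesis
      using card_Times_Collect [of files "encode ` keys" "\<lambda>w. w = x" "\<lambda>_. True"]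
      by (simp add: card_image inj_on_encode)
  qed
  have QW: "card {\<omega> \<in> samples. (?Q \<omega>, all_files \<omega>) = (y, x)} =
      card {w \<in> files. w = x} * card {r \<in> encode ` keys. ?q r = y}" for x y
  proof -
    have "{\<omega> \<in> samples. (?Q \<omega>, all_files \<omega>) = (y, x)} =
        {\<omega> \<in> files \<times> encode ` keys. fst \<omega> = x \<and> ?q (snd \<omega>) = y}"
      using all_files by (auto simp: samples_def query_def)
    then show ?thesis
      by (simp only: card_Times_Collect [where P = "\<lambda>w. w = x" and Q = "\<lambda>r. ?q r = y"])
  qed
  have "card samples \<noteq> 0"
    using finite_sample nonempty_sample by simp
  then have nz: "card files \<noteq> 0" "card keys \<noteq> 0"
    by (simp_all add: card_samples)
  show ?thesis
    by (rule mutual_information_eq_0_simple [OF simple_distributed_uniform simple_distributed_uniform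
          simple_distributed_uniform], unfold Q W QW card_samples) (use nz in \<open>simp add: mult.commute\<close>)
qed

section \<open>Verification of the scheme and its rate\<close>

lemma sc_pir_scheme: "sc_pir_scheme (uniform_count_measure samples) (real M / real N) N K file_length
    (s * (M - 1)) sample_file coords storage query answer"
proof unfold_locales
  fix i assume "i \<in> {1..s * (M - 1)}"
  then have "piece i < s"
    by (rule piece_less)
  then have "S (piece i) \<noteq> {}"
    using pos M_ge_2 by (fastforce simp: bij_betw_def)
  then show "\<exists>n\<in>{1..N}. i \<in> storage n"
    using S_subset [OF \<open>piece i < s\<close>] \<open>i \<in> _\<close> by (auto simp: storage_def)
next
  fix \<theta> n
  show "\<H>(answer \<theta> n | (\<lambda>\<omega>. (query \<theta> n \<omega>, stored n \<omega>))) = 0"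
  proof (rule conditional_entropy_eq_0)
    fix \<omega> \<omega>' assume "(query \<theta> n \<omega>, stored n \<omega>) = (query \<theta> n \<omega>', stored n \<omega>')"
    then show "answer \<theta> n \<omega> = answer \<theta> n \<omega>'"
      by (intro answer_cong) simp_all
  qed
next
  fix \<theta> assume \<theta>: "\<theta> \<in> {1..K}"
  show "\<H>(sample_file \<theta> | (\<lambda>\<omega>. (restrict (\<lambda>n. answer \<theta> n \<omega>) {1..N}, restrict (\<lambda>n. query \<theta> n \<omega>) {1..N}))) = 0"
  proof (rule conditional_entropy_eq_0)
    fix \<omega> \<omega>' assume \<omega>: "\<omega> \<in> samples" "\<omega>' \<in> samples"
      and "(restrict (\<lambda>n. answer \<theta> n \<omega>) {1..N}, restrict (\<lambda>n. query \<theta> n \<omega>) {1..N}) =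
        (restrict (\<lambda>n. answer \<theta> n \<omega>') {1..N}, restrict (\<lambda>n. query \<theta> n \<omega>') {1..N})"
    then have eq: "restrict (\<lambda>n. answer \<theta> n \<omega>) {1..N} = restrict (\<lambda>n. answer \<theta> n \<omega>') {1..N}"
      "restrict (\<lambda>n. query \<theta> n \<omega>) {1..N} = restrict (\<lambda>n. query \<theta> n \<omega>') {1..N}"
      unfolding prod.inject by blast+
    show "sample_file \<theta> \<omega> = sample_file \<theta> \<omega>'"
    proof (rule answers_recover_file [OF \<omega> \<theta>])
      fix n assume "n \<in> {1..N}"
      then show "answer \<theta> n \<omega> = answer \<theta> n \<omega>'" "query \<theta> n \<omega> = query \<theta> n \<omega>'"
        using fun_cong [OF eq(1), of n] fun_cong [OF eq(2), of n] by simp_all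
    qed
  qed
qed (use entropy_packet_eq storage_subset storage_bound queries_files_independent queries_private in blast | simp)+

lemma linear_scheme: "linear_sc_pir_scheme (uniform_count_measure samples) (real M / real N) N K file_length
    (s * (M - 1)) sample_file coords storage query answer"
proof -
  interpret sc_pir_scheme "uniform_count_measure samples" "real M / real N" N K file_length
    "s * (M - 1)" sample_file coords storage query answer
    by (rule sc_pir_scheme)
  show ?thesis
    by unfold_locales (auto simp: answer_def intro!: exI [of _ "\<lambda>_ _. s"] exI [of _ coeff])
qed

text \<open>A geometric sum with ratio \<open>1 / M\<close>.\<close>

lemma capacity_eq: "sc_pir_capacity M K = (M - 1) / (M * (1 - 1 / M ^ K))"
proof -
  have M: "1 < real M"
    using M_ge_2 by simp
  have "(\<Sum>j<K. 1 / real M ^ j) = (\<Sum>j<K. (1 / real M) ^ j)"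
    by (simp add: power_one_over)
  also have "\<dots> = (1 - (1 / M) ^ K) / (1 - 1 / M)"
    using M by (subst sum_gp_strict) simp
  also have "\<dots> = M * (1 - 1 / M ^ K) / (M - 1)"
    using M by (simp add: power_one_over field_simps)
  finally show ?thesis
    by (simp add: sc_pir_capacity_def)
qed

lemma capacity_achieving_scheme: "capacity_achieving_sc_pir_scheme (uniform_count_measure samples)
    (real M / real N) N K file_length (s * (M - 1)) sample_file coords storage query answer"
proof -
  interpret sc_pir_scheme "uniform_count_measure samples" "real M / real N" N K file_length
    "s * (M - 1)" sample_file coords storage query answer
    by (rule sc_pir_scheme)
  have "rate \<theta> = sc_pir_capacity (real M / real N * real N) K" for \<theta>
  proof -
    \<comment> \<open>All \<open>N\<close> servers contribute equally, and this \<open>N\<close>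
      cancels against the one in \<open>file_length\<close>.\<close>
    have "download_cost \<theta> = N * (M * (1 - 1 / M ^ K))"
      unfolding download_cost_def using answer_entropy by simp
    then show ?thesis
      unfolding rate_def using M_ge_2 M_le_N by (simp add: file_length_def capacity_eq)
  qed
  then show ?thesis
    by unfold_locales
qed

end

theorem corollary2:
  fixes N K M :: nat
  assumes "1 \<le> K" and "2 \<le> M" and "M \<le> N"
  shows "\<exists>(\<Omega> :: ((nat \<Rightarrow> 'a list) \<times> nat) measure) L
           (W :: nat \<Rightarrow> (nat \<Rightarrow> 'a list) \<times> nat \<Rightarrow> 'a::{field, finite} list) P I
           (Q :: nat \<Rightarrow> nat \<Rightarrow> (nat \<Rightarrow> 'a list) \<times> nat \<Rightarrow> nat) A.
         let \<mu> = real M / real N;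
             F = eta (N div gcd N M) (M div gcd N M) * (M - 1)
         in linear_sc_pir_scheme \<Omega> \<mu> N K L F W P I Q A \<and>
            capacity_achieving_sc_pir_scheme \<Omega> \<mu> N K L F W P I Q A"
proof -
  have "eta (N div gcd N M) (M div gcd N M) = eta (gcd N M * (N div gcd N M)) (gcd N M * (M div gcd N M))"
    using assms by (intro eta_mult [symmetric]) simp
  then have eta: "eta (N div gcd N M) (M div gcd N M) = eta N M"
    by simp
  obtain S and a :: "nat \<Rightarrow> nat" where
    S: "\<forall>i<eta N M. S i \<subseteq> {1..N} \<and> card (S i) = M \<and> 0 < a i"
    and a: "(\<Sum>i<eta N M. a i) = N" "\<forall>n\<in>{1..N}. (\<Sum>i<eta N M. if n \<in> S i then a i else 0) = M"
    using storage_design [of M N] assms by auto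
  \<comment> \<open>Any enumeration of the \<open>M\<close> servers of a piece can serve as their
    positions.\<close>
  have "\<exists>p. bij_betw p (S i) {..<M}" if "i < eta N M" for i
  proof -
    have "finite (S i)" "card (S i) = M"
      using S that finite_subset [of "S i" "{1..N}"] by auto
    then show ?thesis
      using ex_bij_betw_finite_nat [of "S i"] by (simp add: atLeast0LessThan)
  qed
  then obtain pos where "\<And>i. i < eta N M \<Longrightarrow> bij_betw (pos i) (S i) {..<M}"
    by metis
  then interpret pir_design "TYPE('a)" N K M "eta N M" S a pos
    using assms S a by unfold_locales auto
  show ?thesis
    unfolding Let_def eta using linear_scheme capacity_achieving_scheme by blast
qed

end
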